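(* Let $G=(V,E)$ be a finite quiver without self-loops, with $V=\{1,\dots,p\}$, let $n_v\ge1$ be fixed integers for $v\in V$, with $\underline{n}=(n_1,\dots,n_p)$, and let $(x_e)_{e\in E}$ be complex numbers. Consider any probability distribution on the quiver representation $(U_e)_{e\in E}$ for fixed $\underline{n}$, where $U_e$ is a complex matrix of size $n_{s(e)}\times n_{t(e)}$, and let $\Delta$ be the associated (random) twisted Laplacian. Then, for any integer $k\ge1$, $$\mathbb{E}\left[(\det\Delta)^k\right]=\sum_{\mathsf{C}_1,\dots,\mathsf{C}_k\in\mathcal{C}(G)_{\le\underline{n}}}\left(\prod_{i=1}^k\left[\frac{\underline{z}^{\underline{n}-\underline{v}(\mathsf{C}_i)}}{\mathsf{C}_i!}\prod_{\mathsf{c}_i\in\mathsf{C}_i}\frac{-\underline{x}^{\underline{e}(\mathsf{c}_i)}}{\operatorname{val}(\mathsf{c}_i)}\right]\right)\mathbb{E}\left[\prod_{i=1}^k\prod_{\mathsf{c}_i\in\mathsf{C}_i}\operatorname{Tr}\operatorname{hol}(\mathsf{c}_i)\right],$$ where products over elements of a multiset take multiplicities into account. (The first factor of each summand is called the combinatorial weight, the second the Wilson loop.)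
   Context: A finite quiver is a finite directed graph (multiple edges allowed); each edge $e$ goes from $s(e)$ to $t(e)$, and no self-loops means $s(e)\ne t(e)$ for all $e$. The twisted Laplacian is the endomorphism of $\bigoplus_{v\in V}\mathbb{C}^{n_v}$ given by $\Delta f(v)=\sum_{e\in E:\,s(e)=v}x_e\,[f(s(e))-U_ef(t(e))]$. For $a\in V$, $z_a=\sum_{e\in E:\,s(e)=a}x_e$. A cycle $\mathsf{c}$ on $G$ is a sequence of edges $(e_1,\dots,e_m)$, $m\ge 1$, with $t(e_i)=s(e_{i+1})$ for $1\le i<m$ and $t(e_m)=s(e_1)$, considered up to cyclic permutation (vertices and edges may be repeated). Its valuation $\operatorname{val}(\mathsf{c})$ is the order of the stabiliser of $(e_1,\dots,e_m)$ under the cyclic shift action of $\mathbb{Z}/m\mathbb{Z}$; $\underline{x}^{\underline{e}(\mathsf{c})}=x_{e_1}\cdots x_{e_m}$; $\operatorname{hol}(\mathsf{c})=U_{e_1}\cdots U_{e_m}$, whose trace does not depend on the starting point; $v_a(\mathsf{c})=|\{i:s(e_i)=a\}|$. For a finite multiset $\mathsf{C}$ of cycles, $v_a(\mathsf{C})=\sum_{\mathsf{c}\in\mathsf{C}}v_a(\mathsf{c})$ (with multiplicities), $\underline{v}(\mathsf{C})=(v_a(\mathsf{C}))_{a\in V}$, and $\mathsf{C}!$ is the product of the factorials of the multiplicities. $\mathcal{C}(G)_{\le\underline{n}}$ is the set of multisets $\mathsf{C}$ of cycles on $G$ (including the empty one) with $v_a(\mathsf{C})\le n_a$ for all $a\in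 V$. $\underline{z}^{\underline{n}-\underline{v}(\mathsf{C})}=\prod_{a\in V}z_a^{n_a-v_a(\mathsf{C})}$, with $z^0=1$.
   Formalization: The distribution of the matrices U_e is assumed to be such that every Wilson loop (product of traces of holonomies) on the right-hand side is integrable; for an arbitrary probability distribution these expectations need not exist. *)

theory Defs
  imports
    "HOL-Probability.Probability"
    "Jordan_Normal_Form.Determinant"
    "Graph_Theory.Graph_Theory"
begin

unbundle no vec_syntax
no_notation Finite_Cartesian_Product.vec_nth (infixl "$" 90)

section \<open>The twisted Laplacian\<close>

text \<open>
  A quiver is a \<open>pre_digraph\<close> \<open>G\<close> with \<open>s = tail G\<close> and \<open>t = head G\<close>; multiple arcs are allowed.
  A representation is a map \<open>U\<close> from arcs to matrices, and an element of the direct sum of the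
  spaces \<open>\<complex>^(n v)\<close> is a map \<open>f\<close> with \<open>f v \<in> carrier_vec (n v)\<close>.
\<close>

definition twisted_laplacian ::
    "(nat, 'e) pre_digraph \<Rightarrow> (nat \<Rightarrow> nat) \<Rightarrow> ('e \<Rightarrow> complex) \<Rightarrow> ('e \<Rightarrow> complex mat) \<Rightarrow>
     (nat \<Rightarrow> complex vec) \<Rightarrow> (nat \<Rightarrow> complex vec)" where
  "twisted_laplacian G n x U f = (\<lambda>v.
     finsum_vec TYPE(complex) (n v)
       (\<lambda>e. x e \<cdot>\<^sub>v (f (tail G e) - U e *\<^sub>v f (head G e))) (out_arcs G v))"

text \<open>
  The determinant of an endomorphism of the direct sum is that of its matrix in the standard basis,
  whose elements are labelled by the pairs \<open>(v, i)\<close> with \<open>v\<close> a vertex and \<open>i < n v\<close>.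
\<close>

definition basis_labels :: "(nat, 'e) pre_digraph \<Rightarrow> (nat \<Rightarrow> nat) \<Rightarrow> (nat \<times> nat) list" where
  "basis_labels G n = concat (map (\<lambda>v. map (Pair v) [0..<n v]) (sorted_list_of_set (verts G)))"

definition basis_element :: "(nat \<Rightarrow> nat) \<Rightarrow> nat \<times> nat \<Rightarrow> (nat \<Rightarrow> complex vec)" where
  "basis_element n = (\<lambda>(a, j) v. if v = a then unit_vec (n a) j else 0\<^sub>v (n v))"

definition endo_mat ::
    "(nat, 'e) pre_digraph \<Rightarrow> (nat \<Rightarrow> nat) \<Rightarrow>
     ((nat \<Rightarrow> complex vec) \<Rightarrow> (nat \<Rightarrow> complex vec)) \<Rightarrow> complex mat" where
  "endo_mat G n T = (let bs = basis_labels G n in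
     mat (length bs) (length bs)
       (\<lambda>(r, s). T (basis_element n (bs ! s)) (fst (bs ! r)) $ snd (bs ! r)))"

definition endo_det ::
    "(nat, 'e) pre_digraph \<Rightarrow> (nat \<Rightarrow> nat) \<Rightarrow>
     ((nat \<Rightarrow> complex vec) \<Rightarrow> (nat \<Rightarrow> complex vec)) \<Rightarrow> complex" where
  "endo_det G n T = Determinant.det (endo_mat G n T)"

definition out_weight :: "(nat, 'e) pre_digraph \<Rightarrow> ('e \<Rightarrow> complex) \<Rightarrow> nat \<Rightarrow> complex" where
  "out_weight G x a = (\<Sum>e\<in>out_arcs G a. x e)"

section \<open>Cycles\<close>

text \<open>
  The cycles meant here are all non-empty closed walks up to rotation, repetitions allowed, and not
  those of \<open>pre_digraph.cycle\<close>, which are simple. A cycle is an equivalence class of arc lists.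
\<close>

definition closed_walks :: "('a, 'e) pre_digraph \<Rightarrow> 'e list set" where
  "closed_walks G = {es. es \<noteq> [] \<and> (\<exists>u. pre_digraph.awalk G u es u)}"

definition rotation_rel :: "('a, 'e) pre_digraph \<Rightarrow> ('e list \<times> 'e list) set" where
  "rotation_rel G = {(es, fs). es \<in> closed_walks G \<and> fs \<in> closed_walks G \<and> (\<exists>k. fs = rotate k es)}"

definition cycles :: "('a, 'e) pre_digraph \<Rightarrow> 'e list set set" where
  "cycles G = closed_walks G // rotation_rel G"

text \<open>
  Quantities attached to a cycle are computed on a chosen representative; the lemmas at the end
  show that they are invariant under rotation, except for the holonomy, of which only the trace is.
\<close>

definition walk_of :: "'e list set \<Rightarrow> 'e list" where
  "walk_of c = (SOME es. es \<in> c)"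

definition walk_val :: "'e list \<Rightarrow> nat" where
  "walk_val es = card {k. k < length es \<and> rotate k es = es}"

definition walk_weight :: "('e \<Rightarrow> complex) \<Rightarrow> 'e list \<Rightarrow> complex" where
  "walk_weight x es = prod_list (map x es)"

definition walk_visits :: "('a, 'e) pre_digraph \<Rightarrow> 'e list \<Rightarrow> 'a \<Rightarrow> nat" where
  "walk_visits G es a = card {i. i < length es \<and> tail G (es ! i) = a}"

text \<open>
  The identity matrix terminating the product has the size of the last factor's columns, since
  \<open>t(e_m) = s(e_1)\<close>.
\<close>

definition walk_hol ::
    "('a, 'e) pre_digraph \<Rightarrow> ('a \<Rightarrow> nat) \<Rightarrow> ('e \<Rightarrow> complex mat) \<Rightarrow> 'e list \<Rightarrow> complex mat" where
  "walk_hol G n U es = foldr (\<lambda>e A. U e * A) es (1\<^sub>m (n (tail G (hd es))))"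

definition mat_trace :: "complex mat \<Rightarrow> complex" where
  "mat_trace A = (\<Sum>i<dim_row A. A $$ (i, i))"

definition cycle_val :: "'e list set \<Rightarrow> nat" where
  "cycle_val c = walk_val (walk_of c)"

definition cycle_weight :: "('e \<Rightarrow> complex) \<Rightarrow> 'e list set \<Rightarrow> complex" where
  "cycle_weight x c = walk_weight x (walk_of c)"

definition cycle_visits :: "('a, 'e) pre_digraph \<Rightarrow> 'e list set \<Rightarrow> 'a \<Rightarrow> nat" where
  "cycle_visits G c a = walk_visits G (walk_of c) a"

definition cycle_hol ::
    "('a, 'e) pre_digraph \<Rightarrow> ('a \<Rightarrow> nat) \<Rightarrow> ('e \<Rightarrow> complex mat) \<Rightarrow> 'e list set \<Rightarrow> complex mat" where
  "cycle_hol G n U c = walk_hol G n U (walk_of c)"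

section \<open>Multisets of cycles\<close>

definition mset_visits :: "('a, 'e) pre_digraph \<Rightarrow> 'e list set multiset \<Rightarrow> 'a \<Rightarrow> nat" where
  "mset_visits G C a = (\<Sum>c\<in>#C. cycle_visits G c a)"

definition mset_fact :: "'c multiset \<Rightarrow> nat" where
  "mset_fact C = (\<Prod>c\<in>set_mset C. fact (count C c))"

definition cycle_msets :: "('a, 'e) pre_digraph \<Rightarrow> ('a \<Rightarrow> nat) \<Rightarrow> 'e list set multiset set" where
  "cycle_msets G n =
     {C. set_mset C \<subseteq> cycles G \<and> (\<forall>a\<in>verts G. mset_visits G C a \<le> n a)}"

section \<open>Well-definedness and finiteness\<close>

lemma closed_walks_rotate1:
  assumes "wf_digraph G" "es \<in> closed_walks G"
  shows "rotate1 es \<in> closed_walks G"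
proof -
  interpret wf_digraph G by fact
  from assms(2) obtain u where u: "awalk u es u" and "es \<noteq> []"
    by (auto simp: closed_walks_def)
  then obtain e fs where es: "es = e # fs" by (cases es) auto
  from u es have "awalk (head G e) (fs @ [e]) (head G e)"
    by (auto simp: awalk_Cons_iff awalk_append_iff awalk_Nil_iff)
  then show ?thesis using es by (auto simp: closed_walks_def)
qed

lemma closed_walks_rotate:
  assumes "wf_digraph G" "es \<in> closed_walks G"
  shows "rotate k es \<in> closed_walks G"
  using assms by (induction k) (auto simp: closed_walks_rotate1)

lemma closed_walks_not_Nil: "es \<in> closed_walks G \<Longrightarrow> es \<noteq> []"
  by (auto simp: closed_walks_def)

lemma rotate_inverse: "\<exists>j. rotate j (rotate k es) = es"
proof (induction k)
  case 0
  show ?case by (rule exI[of _ 0]) simp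
next
  case (Suc k)
  then obtain j where j: "rotate j (rotate k es) = es" by blast
  have "rotate (length es - 1) (rotate1 fs) = fs" if "length fs = length es" for fs
  proof (cases fs)
    case (Cons a gs)
    with that have "length es - 1 = length gs" by simp
    with Cons show ?thesis by (simp only: rotate1.simps rotate_append append_Cons append_Nil)
  qed simp
  from this[of "rotate k es"] have "rotate (length es - 1) (rotate (Suc k) es) = rotate k es"
    by simp
  with j have "rotate (j + (length es - 1)) (rotate (Suc k) es) = es"
    by (metis rotate_rotate)
  then show ?case by blast
qed

lemma mset_rotate: "mset (rotate k es) = mset es"
  by (metis add.commute append_take_drop_id mset_append rotate_drop_take)

lemma equiv_rotation_rel: "equiv (closed_walks G) (rotation_rel G)"
proof (rule equivI)
  show "rotation_rel G \<subseteq> closed_walks G \<times> closed_walks G"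
    by (auto simp: rotation_rel_def)
  show "refl_on (closed_walks G) (rotation_rel G)"
    by (auto simp: refl_on_def rotation_rel_def intro: exI[of _ 0])
  show "sym (rotation_rel G)"
    by (auto simp: sym_def rotation_rel_def) (metis rotate_inverse)
  show "trans (rotation_rel G)"
    by (auto simp: trans_def rotation_rel_def) (metis rotate_rotate)
qed

lemma walk_of_mem:
  assumes "c \<in> cycles G"
  shows "walk_of c \<in> c"
  using equiv_rotation_rel assms unfolding cycles_def walk_of_def
  by (metis all_not_in_conv in_quotient_imp_non_empty someI_ex)

lemma walk_of_closed_walks:
  assumes "c \<in> cycles G"
  shows "walk_of c \<in> closed_walks G"
  using equiv_rotation_rel assms walk_of_mem[OF assms] unfolding cycles_def
  by (meson in_quotient_imp_subset subsetD)

lemma cycle_eq_class: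
  assumes "c \<in> cycles G"
  shows "c = rotation_rel G `` {walk_of c}"
proof -
  from assms obtain es where es: "es \<in> closed_walks G" "c = rotation_rel G `` {es}"
    by (auto simp: cycles_def elim: quotientE)
  with walk_of_mem[OF assms] have "(es, walk_of c) \<in> rotation_rel G" by simp
  with es(2) show ?thesis
    using equiv_class_eq[OF equiv_rotation_rel] by blast
qed

lemma walk_of_rotate:
  assumes "c \<in> cycles G" "es \<in> c"
  obtains k where "es = rotate k (walk_of c)"
  using assms cycle_eq_class[OF assms(1)] by (auto simp: rotation_rel_def)

lemma walk_val_rotate: "walk_val (rotate k es) = walk_val es"
proof -
  have "rotate i (rotate k es) = rotate k es \<longleftrightarrow> rotate i es = es" for i
  proof
    assume *: "rotate i (rotate k es) = rotate k es"
    obtain j where j: "rotate j (rotate k es) = es" using rotate_inverse by blast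
    from * have "rotate j (rotate i (rotate k es)) = rotate j (rotate k es)" by simp
    then have "rotate i (rotate j (rotate k es)) = rotate j (rotate k es)"
      by (metis add.commute rotate_rotate)
    then show "rotate i es = es" using j by simp
  next
    assume "rotate i es = es"
    then show "rotate i (rotate k es) = rotate k es"
      by (metis add.commute rotate_rotate)
  qed
  then show ?thesis by (simp add: walk_val_def)
qed

lemma walk_weight_rotate: "walk_weight x (rotate k es) = walk_weight x es"
  unfolding walk_weight_def by (metis mset_map mset_rotate prod_mset_prod_list)

lemma walk_visits_length_filter:
  "walk_visits G es a = length (filter (\<lambda>e. tail G e = a) es)"
  by (simp add: walk_visits_def length_filter_conv_card)

lemma walk_visits_rotate: "walk_visits G (rotate k es) a = walk_visits G es a"
  unfolding walk_visits_length_filter by (metis mset_filter mset_rotate size_mset)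

lemma mat_trace_mult_comm:
  assumes "A \<in> carrier_mat r s" "B \<in> carrier_mat s r"
  shows "mat_trace (A * B) = mat_trace (B * A)"
proof -
  have "mat_trace (A * B) = (\<Sum>i<r. \<Sum>j<s. A $$ (i, j) * B $$ (j, i))"
    using assms by (auto simp: mat_trace_def scalar_prod_def atLeast0LessThan intro!: sum.cong)
  also have "\<dots> = (\<Sum>j<s. \<Sum>i<r. B $$ (j, i) * A $$ (i, j))"
    by (subst sum.swap) (simp add: mult.commute)
  also have "\<dots> = mat_trace (B * A)"
    using assms by (auto simp: mat_trace_def scalar_prod_def atLeast0LessThan intro!: sum.cong)
  finally show ?thesis .
qed

lemma foldr_hol_carrier:
  fixes U :: "'e \<Rightarrow> complex mat"
  assumes "wf_digraph G" and U: "\<And>e. e \<in> arcs G \<Longrightarrow> U e \<in> carrier_mat (n (tail G e)) (n (head G e))"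
    and "pre_digraph.awalk G v fs w" "A \<in> carrier_mat (n w) m"
  shows "foldr (\<lambda>e A. U e * A) fs A \<in> carrier_mat (n v) m \<and>
    foldr (\<lambda>e A. U e * A) fs A = foldr (\<lambda>e A. U e * A) fs (1\<^sub>m (n w)) * A \<and>
    foldr (\<lambda>e A. U e * A) fs (1\<^sub>m (n w)) \<in> carrier_mat (n v) (n w)"
proof -
  interpret wf_digraph G by fact
  show ?thesis using assms(3)
  proof (induction fs arbitrary: v)
    case Nil
    then show ?case using left_mult_one_mat[OF assms(4)] assms(4)
      by (auto simp: awalk_Nil_iff simp del: left_mult_one_mat)
  next
    case (Cons e fs)
    then have "e \<in> arcs G" "v = tail G e" and w: "awalk (head G e) fs w"
      by (auto simp: awalk_Cons_iff)
    with U have "U e \<in> carrier_mat (n v) (n (head G e))" by auto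
    with Cons.IH[OF w] assms(4) show ?case
      by (auto intro!: mult_carrier_mat)
  qed
qed

lemma trace_hol_rotate1:
  assumes "wf_digraph G" and U: "\<And>e. e \<in> arcs G \<Longrightarrow> U e \<in> carrier_mat (n (tail G e)) (n (head G e))"
    and "es \<in> closed_walks G"
  shows "mat_trace (walk_hol G n U (rotate1 es)) = mat_trace (walk_hol G n U es)"
proof -
  interpret wf_digraph G by fact
  let ?F = "foldr (\<lambda>e A. U e * A)"
  from assms(3) obtain u where u: "awalk u es u" and "es \<noteq> []"
    by (auto simp: closed_walks_def)
  then obtain e fs where es: "es = e # fs" by (cases es) auto
  with u have e: "e \<in> arcs G" "u = tail G e" and fs: "awalk (head G e) fs u"
    by (auto simp: awalk_Cons_iff)
  have hd: "tail G (hd (fs @ [e])) = head G e"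
    using fs e by (cases fs) (auto simp: awalk_Cons_iff awalk_Nil_iff)
  have Ue: "U e \<in> carrier_mat (n u) (n (head G e))" using U e by auto
  note P = foldr_hol_carrier[OF assms(1) U fs Ue]
  have "walk_hol G n U (rotate1 es) = ?F fs (U e * 1\<^sub>m (n (head G e)))"
    using hd by (simp add: walk_hol_def es)
  also have "\<dots> = ?F fs (1\<^sub>m (n u)) * U e"
    using P Ue by simp
  finally have "mat_trace (walk_hol G n U (rotate1 es)) = mat_trace (U e * ?F fs (1\<^sub>m (n u)))"
    using mat_trace_mult_comm P Ue by metis
  then show ?thesis using e by (simp add: walk_hol_def es)
qed

lemma trace_hol_rotate:
  assumes "wf_digraph G" and "\<And>e. e \<in> arcs G \<Longrightarrow> U e \<in> carrier_mat (n (tail G e)) (n (head G e))"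
    and "es \<in> closed_walks G"
  shows "mat_trace (walk_hol G n U (rotate k es)) = mat_trace (walk_hol G n U es)"
  by (induction k)
    (simp_all add: trace_hol_rotate1[OF assms(1,2)] closed_walks_rotate[OF assms(1,3)])

lemma sum_walk_visits:
  assumes "fin_digraph G" "set es \<subseteq> arcs G"
  shows "(\<Sum>a\<in>verts G. walk_visits G es a) = length es"
proof -
  interpret fin_digraph G by fact
  show ?thesis using assms(2)
  proof (induction es)
    case (Cons e es)
    have "(\<Sum>a\<in>verts G. walk_visits G (e # es) a) =
        (\<Sum>a\<in>verts G. (if tail G e = a then 1 else 0) + walk_visits G es a)"
      by (rule sum.cong) (auto simp: walk_visits_length_filter)
    then show ?case using Cons by (simp add: sum.distrib)
  qed (simp add: walk_visits_def)
qed

lemma finite_cycle_msets: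
  assumes "fin_digraph G"
  shows "finite (cycle_msets G n)"
proof -
  interpret fin_digraph G by fact
  define N where "N = (\<Sum>a\<in>verts G. n a)"
  define K where "K = {c \<in> cycles G. length (walk_of c) \<le> N}"
  have arcs: "set (walk_of c) \<subseteq> arcs G" "walk_of c \<noteq> []" if "c \<in> cycles G" for c
    using walk_of_closed_walks[OF that] by (auto simp: closed_walks_def awalk_def)
  have "K \<subseteq> (\<lambda>es. rotation_rel G `` {es}) ` {es. set es \<subseteq> arcs G \<and> length es \<le> N}"
  proof
    fix c assume c: "c \<in> K"
    then have "c = rotation_rel G `` {walk_of c}" by (intro cycle_eq_class) (simp add: K_def)
    moreover have "walk_of c \<in> {es. set es \<subseteq> arcs G \<and> length es \<le> N}"
      using c arcs by (simp add: K_def)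
    ultimately show "c \<in> (\<lambda>es. rotation_rel G `` {es}) ` {es. set es \<subseteq> arcs G \<and> length es \<le> N}"
      by (rule image_eqI)
  qed
  then have "finite K"
    by (rule finite_subset) (intro finite_imageI finite_lists_length_le finite_arcs)
  then have fin: "finite {cs. set cs \<subseteq> K \<and> length cs \<le> N}" by (rule finite_lists_length_le)
  have bound: "set_mset C \<subseteq> K \<and> size C \<le> N" if C: "C \<in> cycle_msets G n" for C
  proof -
    have cyc: "c \<in> cycles G" if "c \<in># C" for c using that C by (auto simp: cycle_msets_def)
    have "(\<Sum>c\<in>#C. length (walk_of c)) = (\<Sum>c\<in>#C. \<Sum>a\<in>verts G. cycle_visits G c a)"
      using cyc arcs
      by (intro arg_cong[of _ _ sum_mset] image_mset_cong)
        (simp add: cycle_visits_def sum_walk_visits[OF assms])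
    also have "\<dots> = (\<Sum>a\<in>verts G. mset_visits G C a)"
      by (induction C) (simp_all add: mset_visits_def sum.distrib)
    also have "\<dots> \<le> N"
      using C unfolding N_def by (intro sum_mono) (auto simp: cycle_msets_def)
    finally have le: "(\<Sum>c\<in>#C. length (walk_of c)) \<le> N" .
    have "length (walk_of c) \<le> N" if "c \<in># C" for c
    proof -
      from that obtain D where "C = add_mset c D" by (blast dest: multi_member_split)
      with le show ?thesis by simp
    qed
    moreover have "size C \<le> (\<Sum>c\<in>#C. length (walk_of c))"
    proof -
      have "(\<Sum>c\<in>#C. (1::nat)) \<le> (\<Sum>c\<in>#C. length (walk_of c))"
      proof (rule sum_mset_mono)
        fix c assume "c \<in># C"
        then have "walk_of c \<noteq> []" by (intro arcs cyc)
        then show "1 \<le> length (walk_of c)" by (cases "walk_of c") simp_all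
      qed
      then show ?thesis by (simp only: size_eq_sum_mset)
    qed
    ultimately show ?thesis using cyc le_trans[OF _ le] unfolding K_def by blast
  qed
  have "C \<in> mset ` {cs. set cs \<subseteq> K \<and> length cs \<le> N}" if "C \<in> cycle_msets G n" for C
  proof -
    obtain cs where "C = mset cs" using ex_mset by metis
    with bound[OF that] show ?thesis by simp
  qed
  then have "cycle_msets G n \<subseteq> mset ` {cs. set cs \<subseteq> K \<and> length cs \<le> N}" by blast
  then show ?thesis by (rule finite_subset) (intro finite_imageI fin)
qed

end

theory Submission
  imports
    Defs
    "Jordan_Normal_Form.Schur_Decomposition"
    "HOL-Computational_Algebra.Polynomial_FPS"
    "HOL-Number_Theory.Cong"
begin

text \<open>
  For a fixed representation, the twisted Laplacian has the matrix $D - A$, where $D$ is diagonal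
  with the value $z_a$ on block $a$, and $A$ (\<open>transfer_mat\<close>) collects the terms $x_e U_e$. Formally,
  \[ \det(1 - A) = \exp\Bigl(-\sum_{k \ge 1} \frac{1}{k} \mathrm{Tr}(A^k)\Bigr), \]
  and $\mathrm{Tr}(A^k)$ is a sum over closed walks of length $k$
  (\<open>trace_transfer_mat_power\<close>). Since a cycle of length $k$ and valuation $m$ has $k/m$ starting
  points, the exponent is the sum over all cycles of
  $-x^{e(c)} \mathrm{Tr}\,\mathrm{hol}(c) / \mathrm{val}(c)$ (\<open>sum_cycle_term\<close>), and the exponential is a
  sum over multisets of cycles, in which $1/C!$ appears.

  No exponential is taken. The coefficients of $\det(1 - tA)$ satisfy Newton's identities
  (\<open>newton_identity\<close>, through the eigenvalues of $A$), and the sums over multisets of total length $L$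
  satisfy the same recursion, obtained by marking one cycle of the multiset
  (\<open>mset_weight_recursion\<close>). This gives a finite expansion of $\det(1 - A)$ over the multisets whose total
  length is at most the size of the matrix (\<open>det_one_minus_transfer_mat\<close>).

  To restrict it to multisets that visit each vertex $a$ at most $n_a$ times, multiply the arc weights
  at $a$ by a variable $\lambda_a$. The determinant has degree at most $n_a$ in $\lambda_a$, because block
  $a$ has $n_a$ rows, while the term of $C$ carries the factor
  $\lambda_a^{v_a(C)}$; hence the terms of higher degree cancel
  (\<open>multidegree_truncate\<close>, \<open>det_pencil_one\<close>). For a diagonal $D$ without zeros, $D - A = D(1 - D^{-1}A)$
  introduces the factors $z_a^{n_a - v_a(C)}$, and a continuity argument allows zeros
  (\<open>det_pencil\<close>). Finally, the $k$-th power of this finite sum is expanded and integrated term by term.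
\<close>

section \<open>Newton's identities for a complex matrix\<close>

lemma upper_triangular_pow:
  fixes B :: "complex mat"
  assumes B: "B \<in> carrier_mat N N" and ut: "upper_triangular B"
  shows "upper_triangular (B ^\<^sub>m k) \<and> (\<forall>i<N. (B ^\<^sub>m k) $$ (i, i) = B $$ (i, i) ^ k)"
proof (induction k)
  case 0
  show ?case using B by auto
next
  case (Suc k)
  have Bk: "B ^\<^sub>m k \<in> carrier_mat N N" using B by simp
  have zero: "B $$ (i, j) = 0" "(B ^\<^sub>m k) $$ (i, j) = 0" if "j < i" "i < N" for i j
    using ut Suc that B Bk by (auto simp: upper_triangular_def)
  have entry: "(B ^\<^sub>m Suc k) $$ (i, j) = (\<Sum>l<N. (B ^\<^sub>m k) $$ (i, l) * B $$ (l, j))"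
    if "i < N" "j < N" for i j
    using B Bk that by (simp add: scalar_prod_def atLeast0LessThan)
  have "(B ^\<^sub>m Suc k) $$ (i, j) = 0" if "j < i" "i < N" for i j
  proof -
    have "(B ^\<^sub>m k) $$ (i, l) * B $$ (l, j) = 0" if "l < N" for l
    proof (cases "l < i")
      case True
      then show ?thesis using zero(2) \<open>i < N\<close> by simp
    next
      case False
      then show ?thesis using zero(1)[of j l] \<open>j < i\<close> that by simp
    qed
    then show ?thesis using entry[of i j] that by (simp add: sum.neutral)
  qed
  moreover have "(B ^\<^sub>m Suc k) $$ (i, i) = B $$ (i, i) ^ Suc k" if "i < N" for i
  proof -
    have "(\<Sum>l<N. (B ^\<^sub>m k) $$ (i, l) * B $$ (l, i)) =
        (\<Sum>l<N. if l = i then (B ^\<^sub>m k) $$ (i, i) * B $$ (i, i) else 0)"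
    proof (rule sum.cong)
      fix l assume "l \<in> {..<N}"
      then show "(B ^\<^sub>m k) $$ (i, l) * B $$ (l, i) =
          (if l = i then (B ^\<^sub>m k) $$ (i, i) * B $$ (i, i) else 0)"
        using zero(1)[of i l] zero(2)[of l i] that by (cases l i rule: linorder_cases) auto
    qed simp
    then show ?thesis using entry[OF that that] Suc that by simp
  qed
  ultimately show ?case using B by (auto simp: upper_triangular_def)
qed

text \<open>
  A Schur triangularisation reads off both quantities from the same diagonal, so the list \<open>as\<close> of
  eigenvalues, with algebraic multiplicity, links the determinant to the traces of powers.
\<close>

lemma spectrum_of_powers_and_det:
  fixes A :: "complex mat"
  assumes A: "A \<in> carrier_mat N N"
  obtains as where "length as = N" "\<And>k. mat_trace (A ^\<^sub>m k) = (\<Sum>a\<leftarrow>as. a ^ k)"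
    "Determinant.det (1\<^sub>m N - A) = (\<Prod>a\<leftarrow>as. 1 - a)"
proof -
  obtain as where cp: "char_poly A = (\<Prod>a\<leftarrow>as. [:- a, 1:])" and len: "length as = N"
    using char_poly_factorized[OF A] by blast
  obtain B P Q where "schur_decomposition A as = (B, P, Q)" by (metis prod_cases3)
  from schur_decomposition[OF A cp this]
  have wit: "similar_mat_wit A B P Q" and ut: "upper_triangular B" and diag: "diag_mat B = as"
    by auto
  note W = similar_mat_witD2[OF A wit]
  have "mat_trace (A ^\<^sub>m k) = (\<Sum>a\<leftarrow>as. a ^ k)" for k
  proof -
    have "mat_trace (A ^\<^sub>m k) = mat_trace (P * (B ^\<^sub>m k * Q))"
      using similar_mat_wit_pow_id[OF wit, of k] W by (simp add: assoc_mult_mat[of _ N N _ N _ N])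
    also have "\<dots> = mat_trace (B ^\<^sub>m k * Q * P)"
      using W by (intro mat_trace_mult_comm[of _ N N]) auto
    also have "B ^\<^sub>m k * Q * P = B ^\<^sub>m k"
      using W by (simp add: assoc_mult_mat[of _ N N _ N _ N])
    also have "mat_trace (B ^\<^sub>m k) = (\<Sum>i<N. B $$ (i, i) ^ k)"
      using upper_triangular_pow[OF W(5) ut, of k] W(5) by (simp add: mat_trace_def)
    also have "\<dots> = (\<Sum>a\<leftarrow>as. a ^ k)"
      using W(5) unfolding diag[symmetric] diag_mat_def
      by (simp add: sum_list_sum_nth atLeast0LessThan)
    finally show ?thesis .
  qed
  moreover have "Determinant.det (1\<^sub>m N - A) = (\<Prod>a\<leftarrow>as. 1 - a)"
  proof -
    have "P * (1\<^sub>m N - B) * Q = 1\<^sub>m N - A"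
      using W by (simp add: mult_minus_distrib_mat[of _ N N _ N] minus_mult_distrib_mat[of _ N N _ _ N])
    then have "similar_mat (1\<^sub>m N - A) (1\<^sub>m N - B)"
      using W A unfolding similar_mat_def
      by (intro exI[of _ P] exI[of _ Q] similar_mat_witI[of _ _ N]) auto
    then have "Determinant.det (1\<^sub>m N - A) = Determinant.det (1\<^sub>m N - B)"
      by (rule det_similar)
    also have "\<dots> = prod_list (diag_mat (1\<^sub>m N - B))"
      using W(5) ut by (intro det_upper_triangular[of _ N]) (auto simp: upper_triangular_def)
    also have "diag_mat (1\<^sub>m N - B) = map (\<lambda>a. 1 - a) as"
      using W(5) unfolding diag[symmetric] diag_mat_def by auto
    finally show ?thesis .
  qed
  ultimately show thesis using that len by blast
qed

text \<open>
  The logarithmic derivative of $\prod_a (1 - aX)$ is $-\sum_a a/(1 - aX)$; multiplied by $X$ and by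
  the product, this is an identity of power series, whose coefficient of $X^L$ is Newton's identity.
\<close>

lemma newton_identity:
  fixes as :: "complex list"
  defines "P \<equiv> (\<Prod>a\<leftarrow>as. [:1, - a:])"
  shows "of_nat L * coeff P L = (\<Sum>k=1..L. - (\<Sum>a\<leftarrow>as. a ^ k) * coeff P (L - k))"
proof -
  define S where "S bs = Abs_fps (\<lambda>k. if k = 0 then 0 else - (\<Sum>a\<leftarrow>bs. a ^ k))" for bs :: "complex list"
  define F where "F bs = fps_of_poly (\<Prod>a\<leftarrow>bs. [:1, - a:])" for bs :: "complex list"
  have "fps_X * fps_deriv (F bs) = F bs * S bs" for bs
  proof (induction bs)
    case Nil
    then show ?case by (simp add: F_def S_def fps_eq_iff fps_zero_def)
  next
    case (Cons a bs)
    define l where "l = 1 - fps_const a * fps_X"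
    have "S (a # bs) = S [a] + S bs"
      by (simp add: S_def fps_eq_iff)
    moreover have "F (a # bs) = l * F bs"
      by (simp add: F_def l_def fps_of_poly_mult fps_of_poly_pCons mult.commute
          flip: fps_const_neg)
    moreover have "l * S [a] = - fps_const a * fps_X"
    proof (rule fps_ext)
      fix i
      show "fps_nth (l * S [a]) i = fps_nth (- fps_const a * fps_X) i"
        by (cases i) (auto simp: l_def S_def left_diff_distrib mult.assoc split: nat.split)
    qed
    moreover have "fps_deriv l = - fps_const a" by (simp add: l_def)
    ultimately have "fps_X * fps_deriv (F (a # bs)) = l * S [a] * F bs + l * (fps_X * fps_deriv (F bs))"
      by (simp add: algebra_simps)
    also have "\<dots> = l * S [a] * F bs + l * (F bs * S bs)" using Cons by simp
    also have "\<dots> = F (a # bs) * S (a # bs)"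
      using \<open>S (a # bs) = S [a] + S bs\<close> \<open>F (a # bs) = l * F bs\<close> by (simp add: algebra_simps)
    finally show ?case .
  qed
  then have "fps_nth (fps_X * fps_deriv (F as)) L = fps_nth (S as * F as) L" by (simp add: mult.commute)
  also have "fps_nth (fps_X * fps_deriv (F as)) L = of_nat L * coeff P L"
    by (cases L) (auto simp: F_def P_def)
  also have "fps_nth (S as * F as) L = (\<Sum>k=0..L. fps_nth (S as) k * coeff P (L - k))"
    by (simp add: fps_mult_nth F_def P_def)
  also have "\<dots> = (\<Sum>k=1..L. fps_nth (S as) k * coeff P (L - k))"
    by (rule sum.mono_neutral_right) (auto simp: S_def)
  also have "\<dots> = (\<Sum>k=1..L. - (\<Sum>a\<leftarrow>as. a ^ k) * coeff P (L - k))"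
    by (rule sum.cong) (auto simp: S_def)
  finally show ?thesis .
qed

section \<open>Weighted multisets\<close>

definition msets_of_size :: "'c set \<Rightarrow> ('c \<Rightarrow> nat) \<Rightarrow> nat \<Rightarrow> 'c multiset set" where
  "msets_of_size K len L = {C. set_mset C \<subseteq> K \<and> (\<Sum>c\<in>#C. len c) = L}"

text \<open>
  The term of $\exp(\sum_c w(c))$ that belongs to the multiset \<open>C\<close>.
\<close>

definition mset_weight :: "('c \<Rightarrow> complex) \<Rightarrow> 'c multiset \<Rightarrow> complex" where
  "mset_weight w C = (\<Prod>c\<in>#C. w c) / of_nat (mset_fact C)"

lemma mset_fact_add_mset: "mset_fact (add_mset c D) = Suc (count D c) * mset_fact D"
proof -
  let ?f = "\<lambda>C c. fact (count C c) :: nat"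
  have *: "mset_fact C = (\<Prod>d\<in>insert c (set_mset D). ?f C d)"
    if "set_mset C \<subseteq> insert c (set_mset D)" for C
    unfolding mset_fact_def
    using that by (intro prod.mono_neutral_left) (auto simp: not_in_iff)
  have "mset_fact (add_mset c D) = ?f (add_mset c D) c * (\<Prod>d\<in>set_mset D - {c}. ?f (add_mset c D) d)"
    by (subst *) (simp_all add: prod.insert_remove)
  moreover have "(\<Prod>d\<in>set_mset D - {c}. ?f (add_mset c D) d) = (\<Prod>d\<in>set_mset D - {c}. ?f D d)"
    by (rule prod.cong) auto
  moreover have "mset_fact D = ?f D c * (\<Prod>d\<in>set_mset D - {c}. ?f D d)"
    by (subst *) (auto simp add: prod.insert_remove)
  ultimately show ?thesis by (simp add: algebra_simps)
qed

lemma mset_weight_add_mset: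
  "of_nat (count (add_mset c D) c) * mset_weight w (add_mset c D) = w c * mset_weight w D"
proof -
  have "of_nat (Suc (count D c)) \<noteq> (0 :: complex)" by (rule of_nat_neq_0)
  moreover have "of_nat (mset_fact (add_mset c D)) = (of_nat (Suc (count D c)) * of_nat (mset_fact D) :: complex)"
    by (simp only: mset_fact_add_mset of_nat_mult)
  ultimately show ?thesis by (simp add: mset_weight_def del: of_nat_Suc)
qed

lemma sum_image_mset_multiplicity:
  fixes f :: "'c \<Rightarrow> nat"
  shows "(\<Sum>c\<in>#C. f c) = (\<Sum>c\<in>set_mset C. count C c * f c)"
proof -
  have "(\<Sum>c\<in>#C. f c) = (\<Sum>c\<in>A. count C c * f c)" if "finite A" "set_mset C \<subseteq> A" for A
    using that(2)
  proof (induction C)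
    case (add c C)
    have "(\<Sum>d\<in>A. count (add_mset c C) d * f d) = (\<Sum>d\<in>A. (if d = c then f c else 0) + count C d * f d)"
      by (rule sum.cong) auto
    with add that(1) show ?case by (simp add: sum.distrib)
  qed simp
  then show ?thesis by simp
qed

text \<open>
  The exponential formula in recursive form. Writing \<open>L\<close> as the sum of \<open>len c\<close> over the elements of
  \<open>C\<close> amounts to marking one element \<open>c\<close>; removing it leaves a multiset of size \<open>L - len c\<close>, and the
  multiplicity of \<open>c\<close> absorbs the change in the factorials. The shape is that of Newton's
  identity, so it determines the sums \<open>F L\<close> from the sums of \<open>k * w c\<close> over the \<open>c\<close> of size \<open>k\<close>.
\<close>

lemma mset_weight_recursion:
  fixes w :: "'c \<Rightarrow> complex"
  assumes fin: "\<And>L. finite (msets_of_size K len L)" and pos: "\<And>c. c \<in> K \<Longrightarrow> len c \<ge> 1"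
  defines "F \<equiv> \<lambda>L. \<Sum>C\<in>msets_of_size K len L. mset_weight w C"
  shows "of_nat L * F L = (\<Sum>k=1..L. of_nat k * (\<Sum>c | c \<in> K \<and> len c = k. w c) * F (L - k))"
proof -
  let ?Ms = "msets_of_size K len"
  \<comment> \<open>Singletons embed the elements of size \<open>k\<close> into the multisets of size \<open>k\<close>.\<close>
  have finK: "finite {c \<in> K. len c = k}" for k
  proof (rule inj_on_finite)
    show "inj_on (\<lambda>c. {#c#}) {c \<in> K. len c = k}" by (simp add: inj_on_def)
    show "(\<lambda>c. {#c#}) ` {c \<in> K. len c = k} \<subseteq> ?Ms k" by (auto simp: msets_of_size_def)
  qed (rule fin)
  have "of_nat L * F L = (\<Sum>C\<in>?Ms L. \<Sum>c\<in>set_mset C. of_nat (len c) * (of_nat (count C c) * mset_weight w C))"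
    unfolding F_def sum_distrib_left
  proof (rule sum.cong)
    fix C assume "C \<in> ?Ms L"
    then have "L = (\<Sum>c\<in>set_mset C. count C c * len c)"
      by (simp add: msets_of_size_def flip: sum_image_mset_multiplicity)
    then have "(of_nat L :: complex) = (\<Sum>c\<in>set_mset C. of_nat (count C c) * of_nat (len c))"
      by (simp only: of_nat_sum of_nat_mult)
    then show "of_nat L * mset_weight w C =
        (\<Sum>c\<in>set_mset C. of_nat (len c) * (of_nat (count C c) * mset_weight w C))"
      by (simp add: sum_distrib_left algebra_simps)
  qed simp
  also have "\<dots> = (\<Sum>(C, c)\<in>(SIGMA C:?Ms L. set_mset C). of_nat (len c) * (of_nat (count C c) * mset_weight w C))"
    by (simp add: sum.Sigma fin)
  also have "\<dots> = (\<Sum>(k, c, D)\<in>(SIGMA k:{1..L}. {c \<in> K. len c = k} \<times> ?Ms (L - k)). of_nat k * (w c * mset_weight w D))"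
  proof (rule sum.reindex_bij_witness[where
        i = "\<lambda>(k, c, D). (add_mset c D, c)" and j = "\<lambda>(C, c). (len c, c, C - {#c#})"])
    fix p assume "p \<in> (SIGMA C:?Ms L. set_mset C)"
    then obtain C c where p: "p = (C, c)" and C: "set_mset C \<subseteq> K" "(\<Sum>c\<in>#C. len c) = L" "c \<in># C"
      by (auto simp: msets_of_size_def)
    then obtain D where D: "C = add_mset c D" by (blast dest: multi_member_split)
    show "(case case p of (C, c) \<Rightarrow> (len c, c, C - {#c#}) of (k, c, D) \<Rightarrow> (add_mset c D, c)) = p"
      by (simp add: p D)
    show "(case p of (C, c) \<Rightarrow> (len c, c, C - {#c#})) \<in> (SIGMA k:{1..L}. {c \<in> K. len c = k} \<times> ?Ms (L - k))"
      using C pos[of c] by (auto simp: p D msets_of_size_def)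
    show "(case case p of (C, c) \<Rightarrow> (len c, c, C - {#c#}) of (k, c, D) \<Rightarrow> of_nat k * (w c * mset_weight w D)) =
        (case p of (C, c) \<Rightarrow> of_nat (len c) * (of_nat (count C c) * mset_weight w C))"
      using mset_weight_add_mset[of c D w] by (simp add: p D)
  qed (auto simp: msets_of_size_def)
  also have "\<dots> = (\<Sum>k=1..L. \<Sum>(c, D)\<in>{c \<in> K. len c = k} \<times> ?Ms (L - k). of_nat k * (w c * mset_weight w D))"
    by (subst sum.Sigma) (auto simp: fin finK)
  also have "\<dots> = (\<Sum>k=1..L. of_nat k * (\<Sum>c | c \<in> K \<and> len c = k. w c) * F (L - k))"
  proof (rule sum.cong)
    fix k
    show "(\<Sum>(c, D)\<in>{c \<in> K. len c = k} \<times> ?Ms (L - k). of_nat k * (w c * mset_weight w D)) =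
        of_nat k * (\<Sum>c | c \<in> K \<and> len c = k. w c) * F (L - k)"
      unfolding F_def mult.assoc sum_product
      by (subst sum.cartesian_product) (simp add: sum_distrib_left case_prod_beta)
  qed simp
  finally show ?thesis .
qed

section \<open>Multidegrees of polynomial functions\<close>

text \<open>
  The exponents \<open>v i\<close> may exceed the degree of \<open>q\<close>, but then the corresponding terms cancel in total,
  since the expansion of a polynomial function in powers of \<open>s\<close> is unique.
\<close>

lemma poly_expansion_truncate:
  fixes w :: "'i \<Rightarrow> complex"
  assumes "finite J" and "\<And>s. (\<Sum>i\<in>J. w i * s ^ v i) = poly q s" and "degree q \<le> m"
  shows "(\<Sum>i\<in>J. w i * s ^ v i) = (\<Sum>i | i \<in> J \<and> v i \<le> m. w i * s ^ v i)"
proof -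
  let ?R = "\<lambda>I. \<Sum>i\<in>I. monom (w i) (v i)"
  let ?lo = "{i. i \<in> J \<and> v i \<le> m}" and ?hi = "{i. i \<in> J \<and> \<not> v i \<le> m}"
  have "poly (?R J) = poly q"
    using assms(2) by (auto simp: fun_eq_iff poly_sum poly_monom)
  then have q: "q = ?R J" by (simp add: poly_eq_poly_eq_iff)
  have "q = ?R ?lo + ?R ?hi"
    unfolding q using assms(1) by (subst sum.union_disjoint[symmetric]) (auto intro!: sum.cong)
  moreover have "?R ?hi = 0"
  proof (rule poly_eqI)
    fix k
    show "coeff (?R ?hi) k = coeff 0 k"
    proof (cases "k \<le> m")
      case True
      then show ?thesis by (auto simp: coeff_sum intro!: sum.neutral)
    next
      case False
      then have "coeff q k = 0" using assms(3) by (simp add: coeff_eq_0)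
      moreover have "coeff (?R ?lo) k = 0"
        using False by (auto simp: coeff_sum intro!: sum.neutral)
      ultimately show ?thesis using \<open>q = ?R ?lo + ?R ?hi\<close> by simp
    qed
  qed
  ultimately have "poly (?R J) s = poly (?R ?lo) s" using q by simp
  then show ?thesis by (simp add: poly_sum poly_monom)
qed

text \<open>
  Removes the excessive exponents one variable at a time. Only the degree of \<open>Q\<close> in each single
  variable enters, so the coefficients of \<open>Q\<close> as a polynomial in several variables are never formed.
\<close>

lemma multidegree_truncate:
  fixes w :: "'i \<Rightarrow> complex" and v :: "'i \<Rightarrow> 'a \<Rightarrow> nat" and Q :: "('a \<Rightarrow> complex) \<Rightarrow> complex"
  assumes "finite I" "finite V"
    and Q: "\<And>l. Q l = (\<Sum>i\<in>I. w i * (\<Prod>a\<in>V. l a ^ v i a))"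
    and deg: "\<And>l a. a \<in> V \<Longrightarrow> \<exists>q. degree q \<le> n a \<and> (\<forall>s. Q (l(a := s)) = poly q s)"
  shows "Q l = (\<Sum>i | i \<in> I \<and> (\<forall>a\<in>V. v i a \<le> n a). w i * (\<Prod>a\<in>V. l a ^ v i a))"
proof -
  have "Q l = (\<Sum>i | i \<in> I \<and> (\<forall>a\<in>W. v i a \<le> n a). w i * (\<Prod>a\<in>V. l a ^ v i a))" if "W \<subseteq> V" for W l
    using finite_subset[OF that assms(2)] that
  proof (induction W arbitrary: l rule: finite_induct)
    case empty
    show ?case by (simp add: Q)
  next
    case (insert a W)
    let ?J = "{i. i \<in> I \<and> (\<forall>a\<in>W. v i a \<le> n a)}"
    \<comment> \<open>Everything except the variable at \<open>a\<close> is absorbed into the coefficient \<open>u i\<close>.\<close>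
    define u where "u i = w i * (\<Prod>b\<in>V - {a}. l b ^ v i b)" for i
    have split_off: "w i * (\<Prod>b\<in>V. (l(a := s)) b ^ v i b) = u i * s ^ v i a" for i s
      using insert.prems assms(2)
      by (subst prod.remove[of V a]) (auto simp: u_def intro!: prod.cong)
    obtain q where q: "degree q \<le> n a" "\<And>s. Q (l(a := s)) = poly q s"
      using deg insert.prems by blast
    have "(\<Sum>i\<in>?J. u i * s ^ v i a) = poly q s" for s
      using insert.IH[of "l(a := s)"] insert.prems q(2)[of s] by (simp only: split_off) simp
    from poly_expansion_truncate[OF _ this q(1), of "l a"]
    have "(\<Sum>i\<in>?J. u i * l a ^ v i a) = (\<Sum>i | i \<in> ?J \<and> v i a \<le> n a. u i * l a ^ v i a)"
      using assms(1) by simp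
    moreover have "{i. i \<in> ?J \<and> v i a \<le> n a} = {i. i \<in> I \<and> (\<forall>a\<in>insert a W. v i a \<le> n a)}"
      by auto
    ultimately show ?case
      using insert.IH[of l] insert.prems split_off[of _ "l a", symmetric] by simp
  qed
  from this[of V] show ?thesis by simp
qed

section \<open>Rotations of a walk and labels of the basis\<close>

text \<open>
  Orbit-stabiliser for the cyclic shift: every fibre of \<open>k \<mapsto> rotate k es\<close> on \<open>{..<length es}\<close> is a
  translate modulo \<open>length es\<close> of the stabiliser.
\<close>

lemma card_rotations_times_walk_val:
  assumes "es \<noteq> []"
  shows "card (range (\<lambda>k. rotate k es)) * walk_val es = length es"
proof -
  let ?n = "length es" and ?r = "\<lambda>k. rotate k es"
  let ?fibre = "\<lambda>j. {i \<in> {..<?n}. ?r i = ?r j}"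
  have n: "?n > 0" using assms by simp
  have r_mod: "?r (k mod ?n) = ?r k" for k by (simp add: rotate_conv_mod[symmetric])
  have inj: "inj_on (\<lambda>i. (i + m) mod ?n) {..<?n}" for m
  proof (rule inj_onI)
    fix i i' assume "i \<in> {..<?n}" "i' \<in> {..<?n}" "(i + m) mod ?n = (i' + m) mod ?n"
    then have "i mod ?n = i' mod ?n" using cong_add_rcancel_nat[of i m i' ?n] by (simp add: cong_def)
    then show "i = i'" using \<open>i \<in> _\<close> \<open>i' \<in> _\<close> by simp
  qed
  have fibre: "card (?fibre j) = walk_val es" if "j < ?n" for j
    unfolding walk_val_def
  proof (rule card_bij_eq)
    show "inj_on (\<lambda>i. (i + (?n - j)) mod ?n) (?fibre j)"
      by (rule inj_on_subset[OF inj]) auto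
    show "inj_on (\<lambda>i. (i + j) mod ?n) {k. k < ?n \<and> ?r k = es}"
      by (rule inj_on_subset[OF inj]) auto
    show "(\<lambda>i. (i + (?n - j)) mod ?n) ` ?fibre j \<subseteq> {k. k < ?n \<and> ?r k = es}"
    proof (rule image_subsetI)
      fix i assume i: "i \<in> ?fibre j"
      have "?r (i + (?n - j)) = rotate (?n - j) (?r i)" by (simp add: rotate_rotate add.commute)
      also have "\<dots> = rotate (?n - j) (?r j)" using i by simp
      also have "\<dots> = es" using that by (simp add: rotate_rotate)
      finally show "(i + (?n - j)) mod ?n \<in> {k. k < ?n \<and> ?r k = es}" using n by (simp add: r_mod)
    qed
    show "(\<lambda>i. (i + j) mod ?n) ` {k. k < ?n \<and> ?r k = es} \<subseteq> ?fibre j"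
    proof (rule image_subsetI)
      fix i assume i: "i \<in> {k. k < ?n \<and> ?r k = es}"
      have "?r (i + j) = rotate j (?r i)" by (simp add: rotate_rotate add.commute)
      then show "(i + j) mod ?n \<in> ?fibre j" using n i by (simp add: r_mod)
    qed
  qed auto
  have range: "range ?r = ?r ` {..<?n}"
  proof (intro antisym subsetI)
    fix fs assume "fs \<in> range ?r"
    then obtain k where "fs = ?r (k mod ?n)" by (auto simp: r_mod)
    then show "fs \<in> ?r ` {..<?n}" using n by simp
  qed auto
  have "?n = (\<Sum>i<?n. 1)" by simp
  also have "\<dots> = (\<Sum>fs\<in>?r ` {..<?n}. \<Sum>i | i \<in> {..<?n} \<and> ?r i = fs. 1)"
    by (rule sum.image_gen) simp
  also have "\<dots> = (\<Sum>fs\<in>?r ` {..<?n}. walk_val es)"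
    using fibre by (intro sum.cong) auto
  finally show ?thesis by (simp add: range)
qed

lemma set_basis_labels:
  assumes "finite (verts G)"
  shows "set (basis_labels G n) = (SIGMA v:verts G. {..<n v})"
  using assms by (auto simp: basis_labels_def)

lemma distinct_basis_labels: "distinct (basis_labels G n)"
proof -
  have "distinct (concat (map (\<lambda>v. map (Pair v) [0..<n v]) vs))" if "distinct vs" for vs
    using that by (induction vs) (auto simp: distinct_map inj_on_def)
  then show ?thesis by (simp add: basis_labels_def)
qed

lemma bij_betw_basis_labels:
  assumes "finite (verts G)"
  shows "bij_betw (\<lambda>r. basis_labels G n ! r) {..<length (basis_labels G n)} (SIGMA v:verts G. {..<n v})"
  using bij_betw_nth[OF distinct_basis_labels, of _ G n] set_basis_labels[OF assms] by simp

lemma sum_basis_labels: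
  assumes "finite (verts G)"
  shows "(\<Sum>r<length (basis_labels G n). f (basis_labels G n ! r)) =
    (\<Sum>v\<in>verts G. \<Sum>i<n v. f (v, i))"
  using sum.reindex_bij_betw[OF bij_betw_basis_labels[OF assms], of f n] assms
  by (simp add: sum.Sigma)

lemma prod_basis_labels:
  assumes "finite (verts G)"
  shows "(\<Prod>r<length (basis_labels G n). f (basis_labels G n ! r)) =
    (\<Prod>v\<in>verts G. \<Prod>i<n v. f (v, i))"
  using prod.reindex_bij_betw[OF bij_betw_basis_labels[OF assms], of f n] assms
  by (simp add: prod.Sigma)

lemma length_basis_labels:
  assumes "finite (verts G)"
  shows "length (basis_labels G n) = (\<Sum>v\<in>verts G. n v)"
  using sum_basis_labels[OF assms, of "\<lambda>_. 1 :: nat" n] by simp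

lemma pow_mat_Suc_left:
  assumes "A \<in> carrier_mat N N"
  shows "A ^\<^sub>m Suc k = A * A ^\<^sub>m k"
proof (induction k)
  case (Suc k)
  have "A ^\<^sub>m Suc (Suc k) = (A * A ^\<^sub>m k) * A" using Suc by simp
  also have "\<dots> = A * (A ^\<^sub>m k * A)"
    using assms by (intro assoc_mult_mat[of _ N N _ N _ N]) auto
  finally show ?case by simp
qed (use assms in auto)

section \<open>Closed walks and traces of powers\<close>

text \<open>
  The twisted Laplacian is $D - A$ with $D$ diagonal; these are the entries of $A$, indexed by
  labels of basis vectors.
\<close>

definition transfer_entry ::
    "(nat, 'e) pre_digraph \<Rightarrow> ('e \<Rightarrow> complex) \<Rightarrow> ('e \<Rightarrow> complex mat) \<Rightarrow> nat \<times> nat \<Rightarrow> nat \<times> nat \<Rightarrow> complex" where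
  "transfer_entry G x U = (\<lambda>(v, i) (w, j). \<Sum>e | e \<in> out_arcs G v \<and> head G e = w. x e * U e $$ (i, j))"

definition transfer_mat ::
    "(nat, 'e) pre_digraph \<Rightarrow> (nat \<Rightarrow> nat) \<Rightarrow> ('e \<Rightarrow> complex) \<Rightarrow> ('e \<Rightarrow> complex mat) \<Rightarrow> complex mat" where
  "transfer_mat G n x U = (let bs = basis_labels G n in
     mat (length bs) (length bs) (\<lambda>(r, s). transfer_entry G x U (bs ! r) (bs ! s)))"

definition walk_trace_weight ::
    "(nat, 'e) pre_digraph \<Rightarrow> (nat \<Rightarrow> nat) \<Rightarrow> ('e \<Rightarrow> complex) \<Rightarrow> ('e \<Rightarrow> complex mat) \<Rightarrow> 'e list \<Rightarrow> complex" where
  "walk_trace_weight G n x U es = walk_weight x es * mat_trace (walk_hol G n U es)"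

definition cycle_term ::
    "(nat, 'e) pre_digraph \<Rightarrow> (nat \<Rightarrow> nat) \<Rightarrow> ('e \<Rightarrow> complex) \<Rightarrow> ('e \<Rightarrow> complex mat) \<Rightarrow> 'e list set \<Rightarrow> complex" where
  "cycle_term G n x U c = - cycle_weight x c / of_nat (cycle_val c) * mat_trace (cycle_hol G n U c)"

definition cycle_length :: "'e list set \<Rightarrow> nat" where
  "cycle_length c = length (walk_of c)"

locale quiver_representation = fin_digraph G for G :: "(nat, 'e) pre_digraph" +
  fixes n :: "nat \<Rightarrow> nat" and U :: "'e \<Rightarrow> complex mat"
  assumes U_carrier: "e \<in> arcs G \<Longrightarrow> U e \<in> carrier_mat (n (tail G e)) (n (head G e))"
begin

definition walks :: "nat \<Rightarrow> nat \<Rightarrow> nat \<Rightarrow> 'e list set" where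
  "walks k v w = {es. awalk v es w \<and> length es = k}"

lemma finite_walks: "finite (walks k v w)"
proof (rule finite_subset)
  show "walks k v w \<subseteq> {es. set es \<subseteq> arcs G \<and> length es = k}"
    by (auto simp: walks_def awalk_def)
qed (intro finite_lists_length_eq finite_arcs)

lemma walks_Suc: "walks (Suc k) v w = (\<lambda>(e, es). e # es) ` (SIGMA e:out_arcs G v. walks k (head G e) w)"
proof (intro antisym subsetI)
  fix fs assume fs: "fs \<in> walks (Suc k) v w"
  then obtain e es where "fs = e # es" by (cases fs) (auto simp: walks_def)
  with fs show "fs \<in> (\<lambda>(e, es). e # es) ` (SIGMA e:out_arcs G v. walks k (head G e) w)"
    by (auto simp: walks_def awalk_Cons_iff image_iff)
qed (auto simp: walks_def awalk_Cons_iff)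

lemma sum_walks_Suc:
  "(\<Sum>fs\<in>walks (Suc k) v w. f fs) = (\<Sum>e\<in>out_arcs G v. \<Sum>es\<in>walks k (head G e) w. f (e # es))"
proof -
  have "(\<Sum>fs\<in>walks (Suc k) v w. f fs) =
      (\<Sum>(e, es)\<in>(SIGMA e:out_arcs G v. walks k (head G e) w). f (e # es))"
    unfolding walks_Suc by (subst sum.reindex) (auto simp: inj_on_def case_prod_beta)
  then show ?thesis by (simp add: sum.Sigma finite_walks finite_out_arcs)
qed

lemma transfer_mat_carrier:
  "transfer_mat G n x U \<in> carrier_mat (length (basis_labels G n)) (length (basis_labels G n))"
  by (simp add: transfer_mat_def Let_def)

abbreviation hol_matrix :: "'e list \<Rightarrow> nat \<Rightarrow> complex mat" where
  "hol_matrix es w \<equiv> foldr (\<lambda>e A. U e * A) es (1\<^sub>m (n w))"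

lemma hol_matrix_carrier: "awalk v es w \<Longrightarrow> hol_matrix es w \<in> carrier_mat (n v) (n w)"
  using foldr_hol_carrier[OF wf_digraph_axioms U_carrier] by fastforce

lemma sum_out_arcs_by_head:
  "(\<Sum>w\<in>verts G. \<Sum>e | e \<in> out_arcs G v \<and> head G e = w. f e) = (\<Sum>e\<in>out_arcs G v. f e)"
  by (rule sum.group) auto

text \<open>
  Expanding the power of \<open>A\<close> chooses one arc per factor, and consecutive arcs have to match; the sums
  over the inner basis indices are the matrix products in the holonomy.
\<close>

lemma transfer_mat_power:
  fixes x
  defines "bs \<equiv> basis_labels G n"
  assumes "r < length bs" "s < length bs" and "bs ! r = (v, i)" "bs ! s = (w, j)"
  shows "(transfer_mat G n x U ^\<^sub>m k) $$ (r, s) =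
    (\<Sum>es\<in>walks k v w. walk_weight x es * hol_matrix es w $$ (i, j))"
  using assms(2,4)
proof (induction k arbitrary: r v i)
  case 0
  have mem: "(v, i) \<in> set bs" "(w, j) \<in> set bs" using 0 assms(3,5) by (metis nth_mem)+
  then have *: "v \<in> verts G" "i < n v" "w \<in> verts G" "j < n w"
    by (auto simp: bs_def set_basis_labels)
  have eq: "r = s \<longleftrightarrow> v = w \<and> i = j"
    using 0 assms(3,5) distinct_basis_labels[of G n] nth_eq_iff_index_eq[of bs r s]
    by (auto simp: bs_def)
  have "walks 0 v w = (if v = w then {[]} else {})"
    using * by (auto simp: walks_def awalk_Nil_iff)
  then show ?case
    using 0 assms(3) * eq carrier_matD[OF transfer_mat_carrier[of x]]
    by (auto simp: walk_weight_def bs_def)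
next
  case (Suc k)
  let ?T = "transfer_mat G n x U" and ?N = "length bs"
  let ?P = "\<lambda>u l. \<Sum>es\<in>walks k u w. walk_weight x es * hol_matrix es w $$ (l, j)"
  have T: "?T \<in> carrier_mat ?N ?N" using transfer_mat_carrier by (simp add: bs_def)
  have mem: "(v, i) \<in> set bs" using Suc.prems by (metis nth_mem)
  then have i: "i < n v" by (auto simp: bs_def set_basis_labels)
  have j: "j < n w" using nth_mem[OF assms(3)] assms(5) by (auto simp: bs_def set_basis_labels)
  have "(?T ^\<^sub>m Suc k) $$ (r, s) = (\<Sum>q<?N. ?T $$ (r, q) * (?T ^\<^sub>m k) $$ (q, s))"
    unfolding pow_mat_Suc_left[OF T]
    using T Suc.prems assms(3) by (simp add: scalar_prod_def atLeast0LessThan)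
  also have "\<dots> = (\<Sum>q<?N. transfer_entry G x U (v, i) (bs ! q) * ?P (fst (bs ! q)) (snd (bs ! q)))"
  proof (rule sum.cong)
    fix q assume "q \<in> {..<?N}"
    then show "?T $$ (r, q) * (?T ^\<^sub>m k) $$ (q, s) =
        transfer_entry G x U (v, i) (bs ! q) * ?P (fst (bs ! q)) (snd (bs ! q))"
      using Suc.IH[of q "fst (bs ! q)" "snd (bs ! q)"] Suc.prems
      by (simp add: transfer_mat_def bs_def Let_def)
  qed simp
  also have "\<dots> = (\<Sum>u\<in>verts G. \<Sum>l<n u. transfer_entry G x U (v, i) (u, l) * ?P u l)"
    unfolding bs_def by (subst sum_basis_labels) auto
  also have "\<dots> = (\<Sum>u\<in>verts G. \<Sum>e | e \<in> out_arcs G v \<and> head G e = u.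
      \<Sum>l<n (head G e). x e * U e $$ (i, l) * ?P (head G e) l)"
    by (rule sum.cong) (auto simp: transfer_entry_def sum_distrib_right intro: sum.swap[THEN trans])
  also have "\<dots> = (\<Sum>e\<in>out_arcs G v. \<Sum>l<n (head G e). x e * U e $$ (i, l) * ?P (head G e) l)"
    by (rule sum_out_arcs_by_head)
  also have "\<dots> = (\<Sum>e\<in>out_arcs G v. \<Sum>es\<in>walks k (head G e) w.
      walk_weight x (e # es) * hol_matrix (e # es) w $$ (i, j))"
  proof (rule sum.cong)
    fix e assume e: "e \<in> out_arcs G v"
    have entry: "hol_matrix (e # es) w $$ (i, j) =
        (\<Sum>l<n (head G e). U e $$ (i, l) * hol_matrix es w $$ (l, j))"
      if "es \<in> walks k (head G e) w" for es
      using U_carrier[of e] hol_matrix_carrier[of "head G e" es w] e i j that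
      by (auto simp: walks_def scalar_prod_def atLeast0LessThan)
    have "(\<Sum>l<n (head G e). x e * U e $$ (i, l) * ?P (head G e) l) =
        (\<Sum>es\<in>walks k (head G e) w. \<Sum>l<n (head G e).
           x e * U e $$ (i, l) * (walk_weight x es * hol_matrix es w $$ (l, j)))"
      unfolding sum_distrib_left by (rule sum.swap)
    also have "\<dots> = (\<Sum>es\<in>walks k (head G e) w. walk_weight x (e # es) * hol_matrix (e # es) w $$ (i, j))"
      by (rule sum.cong)
        (simp_all add: entry walk_weight_def sum_distrib_left algebra_simps del: foldr.simps)
    finally show "(\<Sum>l<n (head G e). x e * U e $$ (i, l) * ?P (head G e) l) = \<dots>" .
  qed simp
  finally show ?case by (simp only: sum_walks_Suc)
qed

lemma trace_transfer_mat_power: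
  assumes "k \<ge> 1"
  shows "mat_trace (transfer_mat G n x U ^\<^sub>m k) =
    (\<Sum>es | es \<in> closed_walks G \<and> length es = k. walk_trace_weight G n x U es)"
proof -
  let ?T = "transfer_mat G n x U" and ?bs = "basis_labels G n"
  have start: "v = tail G (hd es)" if "es \<in> walks k v v" for v es
    using that assms by (cases es) (auto simp: walks_def awalk_Cons_iff)
  have "mat_trace (?T ^\<^sub>m k) = (\<Sum>r<length ?bs. (?T ^\<^sub>m k) $$ (r, r))"
    using transfer_mat_carrier[of x] by (simp add: mat_trace_def)
  also have "\<dots> = (\<Sum>r<length ?bs. (\<lambda>(v, i). \<Sum>es\<in>walks k v v. walk_weight x es * hol_matrix es v $$ (i, i)) (?bs ! r))"
    by (rule sum.cong) (auto simp: transfer_mat_power split: prod.split)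
  also have "\<dots> = (\<Sum>v\<in>verts G. \<Sum>i<n v. \<Sum>es\<in>walks k v v. walk_weight x es * hol_matrix es v $$ (i, i))"
    by (subst sum_basis_labels) auto
  also have "\<dots> = (\<Sum>v\<in>verts G. \<Sum>es\<in>walks k v v. \<Sum>i<n v. walk_weight x es * hol_matrix es v $$ (i, i))"
    by (intro sum.cong refl sum.swap)
  also have "\<dots> = (\<Sum>v\<in>verts G. \<Sum>es\<in>walks k v v. walk_trace_weight G n x U es)"
  proof (intro sum.cong refl)
    fix v es assume es: "es \<in> walks k v v"
    then have "hol_matrix es v \<in> carrier_mat (n v) (n v)"
      using hol_matrix_carrier by (auto simp: walks_def)
    then show "(\<Sum>i<n v. walk_weight x es * hol_matrix es v $$ (i, i)) = walk_trace_weight G n x U es"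
      using start[OF es, symmetric]
      by (simp add: walk_trace_weight_def walk_hol_def mat_trace_def sum_distrib_left)
  qed
  also have "\<dots> = (\<Sum>(v, es)\<in>(SIGMA v:verts G. walks k v v). walk_trace_weight G n x U es)"
    by (simp add: sum.Sigma finite_walks)
  also have "\<dots> = (\<Sum>es | es \<in> closed_walks G \<and> length es = k. walk_trace_weight G n x U es)"
  proof (rule sum.reindex_bij_witness[where i = "\<lambda>es. (tail G (hd es), es)" and j = snd])
    fix es assume es: "es \<in> {es. es \<in> closed_walks G \<and> length es = k}"
    then obtain u where "es \<in> walks k u u" by (auto simp: closed_walks_def walks_def)
    with start[OF this] show "(tail G (hd es), es) \<in> (SIGMA v:verts G. walks k v v)"
      by (auto simp: walks_def awalk_def)
  next
    fix p assume "p \<in> (SIGMA v:verts G. walks k v v)"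
    then show "(tail G (hd (snd p)), snd p) = p" "snd p \<in> {es. es \<in> closed_walks G \<and> length es = k}"
      using start assms by (auto simp: closed_walks_def walks_def)
  qed auto
  finally show ?thesis .
qed

lemma cycle_range_rotate:
  assumes "c \<in> cycles G"
  shows "c = range (\<lambda>k. rotate k (walk_of c))"
proof (intro antisym subsetI)
  fix es assume "es \<in> range (\<lambda>k. rotate k (walk_of c))"
  then have "es \<in> rotation_rel G `` {walk_of c}"
    using walk_of_closed_walks[OF assms] closed_walks_rotate[OF wf_digraph_axioms]
    by (auto simp: rotation_rel_def)
  then show "es \<in> c" using cycle_eq_class[OF assms] by blast
qed (auto elim: walk_of_rotate[OF assms])

lemma card_cycle_times_val:
  assumes "c \<in> cycles G"
  shows "card c * cycle_val c = cycle_length c"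
  using card_rotations_times_walk_val[of "walk_of c"] walk_of_closed_walks[OF assms]
    cycle_range_rotate[OF assms]
  by (simp add: cycle_val_def cycle_length_def closed_walks_not_Nil)

lemma cycle_length_pos: "c \<in> cycles G \<Longrightarrow> cycle_length c \<ge> 1"
  using walk_of_closed_walks[of c G] closed_walks_not_Nil[of "walk_of c" G]
  by (cases "walk_of c") (auto simp: cycle_length_def)

text \<open>
  A cycle \<open>c\<close> of length \<open>k\<close> consists of \<open>k / cycle_val c\<close> closed walks, on which \<open>walk_trace_weight\<close>
  is constant. So the division by the valuation turns a sum over closed walks into one over cycles.
\<close>

lemma sum_cycle_term:
  "of_nat k * (\<Sum>c | c \<in> cycles G \<and> cycle_length c = k. cycle_term G n x U c) =
    - (\<Sum>es | es \<in> closed_walks G \<and> length es = k. walk_trace_weight G n x U es)"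
proof -
  let ?W = "{es. es \<in> closed_walks G \<and> length es = k}"
  let ?K = "{c. c \<in> cycles G \<and> cycle_length c = k}"
  let ?class = "\<lambda>es. rotation_rel G `` {es}"
  have finW: "finite ?W"
    by (rule finite_subset[of _ "{es. set es \<subseteq> arcs G \<and> length es = k}"])
      (auto simp: closed_walks_def awalk_def intro: finite_lists_length_eq)
  have class_eq: "?class es = c \<longleftrightarrow> es \<in> c" if "c \<in> cycles G" "es \<in> closed_walks G" for c es
    using that equiv_rotation_rel[of G] cycle_eq_class[OF that(1)] walk_of_closed_walks[OF that(1)]
    by (metis Image_singleton_iff equiv_class_eq equiv_class_self symE equivE)
  have members: "{es \<in> ?W. ?class es = c} = c" if "c \<in> ?K" for c
  proof (intro antisym subsetI)
    fix es assume es: "es \<in> c"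
    from that have c: "c \<in> cycles G" by simp
    obtain j where j: "es = rotate j (walk_of c)" using walk_of_rotate[OF c es] .
    have "es \<in> closed_walks G"
      unfolding j using walk_of_closed_walks[OF c] closed_walks_rotate[OF wf_digraph_axioms] by blast
    then show "es \<in> {es \<in> ?W. ?class es = c}"
      using that class_eq[OF c] es j by (simp add: cycle_length_def)
  qed (use that class_eq in auto)
  have W_image: "?class ` ?W \<subseteq> ?K"
  proof (rule image_subsetI)
    fix es assume es: "es \<in> ?W"
    then have c: "?class es \<in> cycles G" by (auto simp: cycles_def intro: quotientI)
    have "es \<in> ?class es" using es equiv_class_self[OF equiv_rotation_rel] by auto
    from walk_of_rotate[OF c this] show "?class es \<in> ?K"
      using c es by (metis (no_types, lifting) cycle_length_def length_rotate mem_Collect_eq)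
  qed
  have K_image: "?K \<subseteq> ?class ` ?W"
  proof
    fix c assume c: "c \<in> ?K"
    then have "walk_of c \<in> ?W" by (auto simp: cycle_length_def walk_of_closed_walks)
    moreover have "?class (walk_of c) = c" using c cycle_eq_class by blast
    ultimately show "c \<in> ?class ` ?W" by blast
  qed
  have finK: "finite ?K" using K_image finW by (rule finite_surj[rotated])
  have "(\<Sum>es\<in>?W. walk_trace_weight G n x U es) =
      (\<Sum>c\<in>?K. \<Sum>es | es \<in> ?W \<and> ?class es = c. walk_trace_weight G n x U es)"
    by (rule sum.group[OF finW finK W_image, symmetric])
  also have "\<dots> = (\<Sum>c\<in>?K. of_nat (card c) * walk_trace_weight G n x U (walk_of c))"
  proof (rule sum.cong)
    fix c assume c: "c \<in> ?K"
    then have "walk_trace_weight G n x U es = walk_trace_weight G n x U (walk_of c)" if "es \<in> c" for es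
      using walk_of_rotate[OF _ that] walk_of_closed_walks[of c G]
      by (metis (no_types, lifting) U_carrier mem_Collect_eq trace_hol_rotate walk_trace_weight_def
          walk_weight_rotate wf_digraph_axioms)
    then show "(\<Sum>es | es \<in> ?W \<and> ?class es = c. walk_trace_weight G n x U es) =
        of_nat (card c) * walk_trace_weight G n x U (walk_of c)"
      using members[OF c] by simp
  qed simp
  also have "\<dots> = (\<Sum>c\<in>?K. - of_nat k * cycle_term G n x U c)"
  proof (rule sum.cong)
    fix c assume c: "c \<in> ?K"
    then have eq: "card c * cycle_val c = k" and "k \<ge> 1"
      using card_cycle_times_val cycle_length_pos by auto
    then have "cycle_val c \<noteq> 0" by auto
    then show "of_nat (card c) * walk_trace_weight G n x U (walk_of c) = - of_nat k * cycle_term G n x U c"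
      using eq[symmetric]
      by (simp add: cycle_term_def walk_trace_weight_def cycle_weight_def cycle_hol_def)
  qed simp
  finally show ?thesis by (simp add: sum_distrib_left sum_negf)
qed

section \<open>Cycle expansion by total length\<close>

lemma finite_msets_of_cycles: "finite (msets_of_size (cycles G) cycle_length L)"
proof (rule finite_subset)
  have "mset_visits G C a \<le> (\<Sum>c\<in>#C. cycle_length c)" for C a
    unfolding mset_visits_def
    by (intro sum_mset_mono) (simp add: cycle_visits_def cycle_length_def walk_visits_length_filter)
  then show "msets_of_size (cycles G) cycle_length L \<subseteq> cycle_msets G (\<lambda>_. L)"
    by (auto simp: msets_of_size_def cycle_msets_def)
qed (rule finite_cycle_msets[OF fin_digraph_axioms])

lemma msets_of_cycles_0: "msets_of_size (cycles G) cycle_length 0 = {{#}}"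
proof -
  have "C = {#}" if "set_mset C \<subseteq> cycles G" "(\<Sum>c\<in>#C. cycle_length c) = 0" for C
  proof (cases C)
    case (add c D)
    then show ?thesis using that cycle_length_pos[of c] by simp
  qed
  then show ?thesis by (auto simp: msets_of_size_def)
qed

text \<open>
  Let \<open>as\<close> be the eigenvalues of \<open>A\<close>. The coefficients of $\prod_a (1 - aX)$ and the sums of \<open>mset_weight\<close>
  over the multisets of total length \<open>L\<close> satisfy the same recursion, because the power sums of the
  eigenvalues are traces of powers and hence sums over closed walks. Evaluation at $X = 1$ gives the
  determinant, and the degree of the product bounds the total length.
\<close>

lemma det_one_minus_transfer_mat:
  fixes x
  defines "N \<equiv> \<Sum>v\<in>verts G. n v"
  shows "Determinant.det (1\<^sub>m N - transfer_mat G n x U) =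
    (\<Sum>C | set_mset C \<subseteq> cycles G \<and> (\<Sum>c\<in>#C. cycle_length c) \<le> N. mset_weight (cycle_term G n x U) C)"
proof -
  let ?T = "transfer_mat G n x U" and ?w = "mset_weight (cycle_term G n x U)"
  let ?Ms = "msets_of_size (cycles G) cycle_length"
  define F where "F L = (\<Sum>C\<in>?Ms L. ?w C)" for L
  have T: "?T \<in> carrier_mat N N"
    using transfer_mat_carrier by (simp add: N_def length_basis_labels)
  obtain as where len: "length as = N" and tr: "\<And>k. mat_trace (?T ^\<^sub>m k) = (\<Sum>a\<leftarrow>as. a ^ k)"
    and det: "Determinant.det (1\<^sub>m N - ?T) = (\<Prod>a\<leftarrow>as. 1 - a)"
    using spectrum_of_powers_and_det[OF T] by blast
  define P where "P = (\<Prod>a\<leftarrow>as. [:1, - a:])"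
  have "coeff P L = F L" for L
  proof (induction L rule: less_induct)
    case (less L)
    show ?case
    proof (cases "L = 0")
      case True
      have "coeff (\<Prod>a\<leftarrow>bs. [:1, - a:]) 0 = 1" for bs :: "complex list"
        by (induction bs) (simp_all add: coeff_mult)
      then have "coeff P 0 = 1" by (simp add: P_def)
      then show ?thesis
        using True by (simp add: F_def msets_of_cycles_0 mset_weight_def mset_fact_def)
    next
      case False
      have "of_nat L * coeff P L = (\<Sum>k=1..L. - (\<Sum>a\<leftarrow>as. a ^ k) * coeff P (L - k))"
        unfolding P_def by (rule newton_identity)
      also have "\<dots> = (\<Sum>k=1..L. of_nat k * (\<Sum>c | c \<in> cycles G \<and> cycle_length c = k. cycle_term G n x U c) * F (L - k))"
      proof (rule sum.cong)
        fix k assume k: "k \<in> {1..L}"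
        then have "coeff P (L - k) = F (L - k)" using False by (intro less) auto
        moreover have "- (\<Sum>a\<leftarrow>as. a ^ k) = of_nat k * (\<Sum>c | c \<in> cycles G \<and> cycle_length c = k. cycle_term G n x U c)"
          using k trace_transfer_mat_power[of k x] by (simp add: sum_cycle_term tr)
        ultimately show "- (\<Sum>a\<leftarrow>as. a ^ k) * coeff P (L - k) =
            of_nat k * (\<Sum>c | c \<in> cycles G \<and> cycle_length c = k. cycle_term G n x U c) * F (L - k)" by simp
      qed simp
      also have "\<dots> = of_nat L * F L"
        unfolding F_def
        by (rule mset_weight_recursion[symmetric, OF finite_msets_of_cycles cycle_length_pos])
      finally show ?thesis using False by simp
    qed
  qed
  moreover have "degree P \<le> N"
  proof -
    have "degree (\<Prod>a\<leftarrow>bs. [:1, - a:]) \<le> length bs" for bs :: "complex list"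
    proof (induction bs)
      case (Cons a bs)
      have "degree ([:1, - a:] * (\<Prod>a\<leftarrow>bs. [:1, - a:])) \<le> degree [:1, - a:] + degree (\<Prod>a\<leftarrow>bs. [:1, - a:])"
        by (rule degree_mult_le)
      also have "\<dots> \<le> 1 + length bs" using Cons by (intro add_mono) auto
      finally show ?case by simp
    qed simp
    from this[of as] show ?thesis by (simp add: P_def len)
  qed
  moreover have "Determinant.det (1\<^sub>m N - ?T) = poly P 1"
    by (simp add: det P_def poly_prod_list o_def)
  moreover have "poly P 1 = (\<Sum>L\<le>N. coeff P L)" if "degree P \<le> N"
    using that coeff_eq_0[of P] unfolding poly_altdef by (intro sum.mono_neutral_cong_left) auto
  ultimately have "Determinant.det (1\<^sub>m N - ?T) = (\<Sum>L\<le>N. F L)"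
    by simp
  also have "\<dots> = (\<Sum>C\<in>(\<Union>L\<le>N. ?Ms L). ?w C)"
    unfolding F_def
    by (rule sum.UNION_disjoint[symmetric])
      (simp, simp add: finite_msets_of_cycles, auto simp: msets_of_size_def)
  also have "(\<Union>L\<le>N. ?Ms L) = {C. set_mset C \<subseteq> cycles G \<and> (\<Sum>c\<in>#C. cycle_length c) \<le> N}"
    by (auto simp: msets_of_size_def)
  finally show ?thesis .
qed

section \<open>Rescaling the arc weights vertex by vertex\<close>

lemma cycle_length_eq_sum_visits:
  assumes "c \<in> cycles G"
  shows "cycle_length c = (\<Sum>a\<in>verts G. cycle_visits G c a)"
proof -
  have "set (walk_of c) \<subseteq> arcs G"
    using walk_of_closed_walks[OF assms] by (auto simp: closed_walks_def awalk_def)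
  from sum_walk_visits[OF fin_digraph_axioms this] show ?thesis
    by (simp add: cycle_length_def cycle_visits_def)
qed

lemma cycle_msets_bounded_length:
  "cycle_msets G n = {C. set_mset C \<subseteq> cycles G \<and> (\<Sum>c\<in>#C. cycle_length c) \<le> (\<Sum>v\<in>verts G. n v) \<and>
     (\<forall>a\<in>verts G. mset_visits G C a \<le> n a)}"
proof -
  have len: "(\<Sum>c\<in>#C. cycle_length c) = (\<Sum>a\<in>verts G. mset_visits G C a)" if "set_mset C \<subseteq> cycles G" for C
    using that by (induction C) (simp_all add: mset_visits_def sum.distrib cycle_length_eq_sum_visits)
  show ?thesis unfolding cycle_msets_def by (auto simp: len intro!: sum_mono)
qed

text \<open>
  Multiplying the weights of the arcs that leave \<open>a\<close> by \<open>l a\<close> multiplies the rows of block \<open>a\<close> of the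
  transfer matrix by \<open>l a\<close>, and the term of a multiset \<open>C\<close> by \<open>l a\<close> to the power \<open>mset_visits G C a\<close>.
  The variables \<open>l a\<close> therefore record how often each vertex is visited.
\<close>

definition rescale :: "(nat \<Rightarrow> complex) \<Rightarrow> ('e \<Rightarrow> complex) \<Rightarrow> 'e \<Rightarrow> complex" where
  "rescale l x e = l (tail G e) * x e"

lemma transfer_entry_rescale:
  "transfer_entry G (rescale l x) U p q = l (fst p) * transfer_entry G x U p q"
  by (auto simp: transfer_entry_def rescale_def sum_distrib_left split: prod.split intro!: sum.cong)

lemma walk_weight_rescale:
  "set es \<subseteq> arcs G \<Longrightarrow>
    walk_weight (rescale l x) es = (\<Prod>a\<in>verts G. l a ^ walk_visits G es a) * walk_weight x es"
proof (induction es)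
  case (Cons e es)
  have "(\<Prod>a\<in>verts G. l a ^ walk_visits G (e # es) a) =
      (\<Prod>a\<in>verts G. (if a = tail G e then l (tail G e) else 1) * l a ^ walk_visits G es a)"
    by (rule prod.cong) (auto simp: walk_visits_length_filter)
  also have "\<dots> = l (tail G e) * (\<Prod>a\<in>verts G. l a ^ walk_visits G es a)"
    using Cons.prems by (simp add: prod.distrib)
  finally show ?case using Cons by (simp add: walk_weight_def rescale_def)
qed (simp add: walk_weight_def walk_visits_def)

lemma mset_weight_rescale:
  assumes "set_mset C \<subseteq> cycles G"
  shows "mset_weight (cycle_term G n (rescale l x) U) C =
    (\<Prod>a\<in>verts G. l a ^ mset_visits G C a) * mset_weight (cycle_term G n x U) C"
proof -
  have *: "cycle_term G n (rescale l x) U c = (\<Prod>a\<in>verts G. l a ^ cycle_visits G c a) * cycle_term G n x U c"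
    if "c \<in> cycles G" for c
  proof -
    have "set (walk_of c) \<subseteq> arcs G"
      using walk_of_closed_walks[OF that] by (auto simp: closed_walks_def awalk_def)
    from walk_weight_rescale[OF this, of l x] show ?thesis
      by (simp add: cycle_term_def cycle_weight_def cycle_visits_def)
  qed
  have "(\<Prod>c\<in>#C. cycle_term G n (rescale l x) U c) =
      (\<Prod>a\<in>verts G. l a ^ mset_visits G C a) * (\<Prod>c\<in>#C. cycle_term G n x U c)"
    using assms by (induction C) (auto simp: mset_visits_def * power_add prod.distrib algebra_simps)
  then show ?thesis by (simp add: mset_weight_def)
qed

section \<open>Cycle expansion by multidegree\<close>

text \<open>
  The matrix $D - A$ with an arbitrary value \<open>d a\<close> on the diagonal of block \<open>a\<close>. Keeping \<open>d\<close>
  independent of the arc weights makes it possible to divide by it and to perturb it.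
\<close>

definition pencil :: "(nat \<Rightarrow> complex) \<Rightarrow> ('e \<Rightarrow> complex) \<Rightarrow> complex mat" where
  "pencil d x = (let bs = basis_labels G n in mat (length bs) (length bs)
     (\<lambda>(r, s). (if r = s then d (fst (bs ! r)) else 0) - transfer_entry G x U (bs ! r) (bs ! s)))"

lemma det_pencil_Leibniz:
  "Determinant.det (pencil d x) = (let bs = basis_labels G n in
     \<Sum>\<pi> | \<pi> permutes {0..<length bs}. signof \<pi> *
       (\<Prod>r<length bs. (if r = \<pi> r then d (fst (bs ! r)) else 0) - transfer_entry G x U (bs ! r) (bs ! \<pi> r)))"
proof -
  let ?N = "length (basis_labels G n)"
  have carrier: "pencil d x \<in> carrier_mat ?N ?N" by (simp add: pencil_def Let_def)
  have entry: "pencil d x $$ (r, \<pi> r) = (if r = \<pi> r then d (fst (basis_labels G n ! r)) else 0)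
      - transfer_entry G x U (basis_labels G n ! r) (basis_labels G n ! \<pi> r)"
    if "\<pi> permutes {0..<?N}" "r < ?N" for \<pi> r
    using permutes_in_image[OF that(1), of r] that(2) by (simp add: pencil_def Let_def)
  show ?thesis
    unfolding det_def'[OF carrier] Let_def atLeast0LessThan[symmetric]
    by (intro sum.cong prod.cong arg_cong2[where f = "(*)"] refl) (simp add: entry)
qed

lemma pencil_one: "pencil (\<lambda>_. 1) x = 1\<^sub>m (\<Sum>v\<in>verts G. n v) - transfer_mat G n x U"
  by (rule eq_matI) (auto simp: pencil_def transfer_mat_def Let_def length_basis_labels)

lemma det_pencil_rescale:
  "Determinant.det (pencil d (rescale d x)) =
    (\<Prod>a\<in>verts G. d a ^ n a) * Determinant.det (pencil (\<lambda>_. 1) x)"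
proof -
  let ?bs = "basis_labels G n"
  have "(\<Prod>r<length ?bs. (if r = \<pi> r then d (fst (?bs ! r)) else 0)
        - transfer_entry G (rescale d x) U (?bs ! r) (?bs ! \<pi> r)) =
      (\<Prod>r<length ?bs. d (fst (?bs ! r))) *
      (\<Prod>r<length ?bs. (if r = \<pi> r then 1 else 0) - transfer_entry G x U (?bs ! r) (?bs ! \<pi> r))" for \<pi>
    unfolding prod.distrib[symmetric]
    by (rule prod.cong) (auto simp: transfer_entry_rescale algebra_simps)
  moreover have "(\<Prod>r<length ?bs. d (fst (?bs ! r))) = (\<Prod>a\<in>verts G. d a ^ n a)"
    by (subst prod_basis_labels) auto
  ultimately show ?thesis
    by (simp add: det_pencil_Leibniz Let_def sum_distrib_left algebra_simps)
qed

text \<open>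
  Only the \<open>n a\<close> rows of block \<open>a\<close> contain \<open>s\<close>, each of them linearly, so every term of the Leibniz
  formula has degree at most \<open>n a\<close> in \<open>s\<close>.
\<close>

lemma det_pencil_one_poly:
  assumes "a \<in> verts G"
  shows "\<exists>q. degree q \<le> n a \<and>
    (\<forall>s. Determinant.det (pencil (\<lambda>_. 1) (rescale (l(a := s)) x)) = poly q s)"
proof -
  let ?bs = "basis_labels G n"
  let ?N = "length ?bs"
  define t where "t \<pi> r = transfer_entry G x U (?bs ! r) (?bs ! \<pi> r)" for \<pi> r
  define \<delta> :: "(nat \<Rightarrow> nat) \<Rightarrow> nat \<Rightarrow> complex" where "\<delta> \<pi> r = (if r = \<pi> r then 1 else 0)" for \<pi> r
  define f where "f \<pi> r = (if fst (?bs ! r) = a then [:\<delta> \<pi> r, - t \<pi> r:]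
      else [:\<delta> \<pi> r - l (fst (?bs ! r)) * t \<pi> r:])" for \<pi> r
  define q where "q = (\<Sum>\<pi> | \<pi> permutes {0..<?N}. Polynomial.smult (signof \<pi>) (\<Prod>r<?N. f \<pi> r))"
  have "degree (\<Prod>r<?N. f \<pi> r) \<le> n a" for \<pi>
  proof -
    have "degree (\<Prod>r<?N. f \<pi> r) \<le> (\<Sum>r<?N. degree (f \<pi> r))"
      using degree_prod_sum_le[of "{..<?N}" "f \<pi>"] by (simp add: o_def)
    also have "\<dots> \<le> (\<Sum>r<?N. if fst (?bs ! r) = a then 1 else 0)"
      by (rule sum_mono) (auto simp: f_def)
    also have "\<dots> = (\<Sum>v\<in>verts G. \<Sum>i<n v. if v = a then 1 else 0)"
      by (subst sum_basis_labels[where f = "\<lambda>p. if fst p = a then 1 else 0"]) auto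
    also have "\<dots> = (\<Sum>v\<in>verts G. if v = a then n a else 0)"
      by (rule sum.cong) auto
    also have "\<dots> = n a" using assms by simp
    finally show ?thesis .
  qed
  then have "degree q \<le> n a"
    unfolding q_def by (intro degree_sum_le) (auto simp: finite_permutations intro: order_trans[OF degree_smult_le])
  moreover have "Determinant.det (pencil (\<lambda>_. 1) (rescale (l(a := s)) x)) = poly q s" for s
    unfolding det_pencil_Leibniz Let_def q_def poly_sum poly_smult poly_prod
    by (intro sum.cong prod.cong arg_cong2[where f = "(*)"] refl)
      (auto simp: f_def t_def \<delta>_def transfer_entry_rescale)
  ultimately show ?thesis by blast
qed

text \<open>
  The bound on the total length is replaced by the finer bound at every vertex. The discarded
  multisets cancel, since their multidegree in \<open>l\<close> exceeds that of the determinant.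
\<close>

lemma det_pencil_one:
  "Determinant.det (pencil (\<lambda>_. 1) x) = (\<Sum>C\<in>cycle_msets G n. mset_weight (cycle_term G n x U) C)"
proof -
  let ?I = "{C. set_mset C \<subseteq> cycles G \<and> (\<Sum>c\<in>#C. cycle_length c) \<le> (\<Sum>v\<in>verts G. n v)}"
  let ?w = "mset_weight (cycle_term G n x U)"
  have "?I = (\<Union>L\<le>\<Sum>v\<in>verts G. n v. msets_of_size (cycles G) cycle_length L)"
    by (auto simp: msets_of_size_def)
  then have fin: "finite ?I" by (simp add: finite_msets_of_cycles)
  have "Determinant.det (pencil (\<lambda>_. 1) (rescale l x)) =
      (\<Sum>C\<in>?I. ?w C * (\<Prod>a\<in>verts G. l a ^ mset_visits G C a))" for l
    unfolding pencil_one det_one_minus_transfer_mat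
    by (rule sum.cong) (auto simp: mset_weight_rescale)
  from multidegree_truncate[OF fin finite_verts this det_pencil_one_poly, of "\<lambda>_. 1"]
  have "Determinant.det (pencil (\<lambda>_. 1) (rescale (\<lambda>_. 1) x)) =
      (\<Sum>C | C \<in> ?I \<and> (\<forall>a\<in>verts G. mset_visits G C a \<le> n a). ?w C)" by simp
  moreover have "rescale (\<lambda>_. 1) x = x" by (simp add: fun_eq_iff rescale_def)
  moreover have "{C. C \<in> ?I \<and> (\<forall>a\<in>verts G. mset_visits G C a \<le> n a)} = cycle_msets G n"
    by (subst cycle_msets_bounded_length) auto
  ultimately show ?thesis by simp
qed

text \<open>
  Write $D - A = D(1 - D^{-1}A)$; the factor $D^{-1}$ is a rescaling of the arc weights.
\<close>

lemma det_pencil_nonzero: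
  assumes d: "\<And>a. a \<in> verts G \<Longrightarrow> d a \<noteq> 0"
  shows "Determinant.det (pencil d x) = (\<Sum>C\<in>cycle_msets G n.
    (\<Prod>a\<in>verts G. d a ^ (n a - mset_visits G C a)) * mset_weight (cycle_term G n x U) C)"
proof -
  \<comment> \<open>Weights for which the transfer matrix becomes $D^{-1}A$.\<close>
  let ?y = "rescale (\<lambda>a. 1 / d a) x"
  have "pencil d (rescale d ?y) = pencil d x"
  proof -
    have "transfer_entry G (rescale d ?y) U p q = transfer_entry G x U p q" if "fst p \<in> verts G" for p q
      using d[OF that] by (simp add: transfer_entry_rescale)
    moreover have "fst (basis_labels G n ! r) \<in> verts G" if "r < length (basis_labels G n)" for r
      using nth_mem[OF that] by (auto simp: set_basis_labels)
    ultimately show ?thesis by (intro eq_matI) (auto simp: pencil_def Let_def)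
  qed
  then have "Determinant.det (pencil d x) =
      (\<Prod>a\<in>verts G. d a ^ n a) * (\<Sum>C\<in>cycle_msets G n. mset_weight (cycle_term G n ?y U) C)"
    using det_pencil_rescale[of d ?y] by (simp add: det_pencil_one)
  also have "\<dots> = (\<Sum>C\<in>cycle_msets G n.
      (\<Prod>a\<in>verts G. d a ^ (n a - mset_visits G C a)) * mset_weight (cycle_term G n x U) C)"
    unfolding sum_distrib_left
  proof (rule sum.cong)
    fix C assume C: "C \<in> cycle_msets G n"
    have "(\<Prod>a\<in>verts G. d a ^ n a) * (\<Prod>a\<in>verts G. (1 / d a) ^ mset_visits G C a) =
        (\<Prod>a\<in>verts G. d a ^ (n a - mset_visits G C a))"
      unfolding prod.distrib[symmetric]
      using C d by (intro prod.cong) (auto simp: cycle_msets_def power_diff power_one_over divide_simps)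
    then show "(\<Prod>a\<in>verts G. d a ^ n a) * mset_weight (cycle_term G n ?y U) C =
        (\<Prod>a\<in>verts G. d a ^ (n a - mset_visits G C a)) * mset_weight (cycle_term G n x U) C"
      using C by (simp add: mset_weight_rescale cycle_msets_def flip: mult.assoc)
  qed simp
  finally show ?thesis .
qed

text \<open>
  Both sides are continuous in \<open>d\<close>, and \<open>d\<close> shifted by a small non-zero \<open>t\<close> has no zeros at the vertices.
\<close>

lemma det_pencil:
  "Determinant.det (pencil d x) = (\<Sum>C\<in>cycle_msets G n.
    (\<Prod>a\<in>verts G. d a ^ (n a - mset_visits G C a)) * mset_weight (cycle_term G n x U) C)"
  (is "_ = ?R d")
proof -
  let ?L = "\<lambda>d. Determinant.det (pencil d x)"
  let ?shift = "\<lambda>t a. d a + t"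
  have "eventually (\<lambda>t. \<forall>a\<in>verts G. t \<noteq> - d a) (at 0)"
    by (auto simp: eventually_ball_finite_distrib intro: eventually_neq_at_within)
  then have eq: "eventually (\<lambda>t. ?L (?shift t) = ?R (?shift t)) (at 0)"
  proof eventually_elim
    case (elim t)
    then show ?case by (intro det_pencil_nonzero) (auto simp: add_eq_0_iff)
  qed
  have L: "((\<lambda>t. ?L (?shift t)) \<longlongrightarrow> ?L (?shift 0)) (at 0)"
  proof -
    have "((\<lambda>t. (if P then ?shift t a else 0) - z) \<longlongrightarrow> (if P then ?shift 0 a else 0) - z) (at 0)"
      for P a z by (auto intro!: tendsto_eq_intros)
    then show ?thesis
      unfolding det_pencil_Leibniz Let_def by (intro tendsto_sum tendsto_mult tendsto_const tendsto_prod)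
  qed
  have R: "((\<lambda>t. ?R (?shift t)) \<longlongrightarrow> ?R (?shift 0)) (at 0)"
    by (intro tendsto_intros)
  have "?L (?shift 0) = ?R (?shift 0)"
    using L[unfolded tendsto_cong[OF eq]] R by (rule tendsto_unique[OF at_neq_bot])
  then show ?thesis by simp
qed

section \<open>The twisted Laplacian\<close>

lemma endo_mat_twisted_laplacian:
  "endo_mat G n (twisted_laplacian G n x U) = pencil (out_weight G x) x"
proof -
  let ?bs = "basis_labels G n"
  have entry: "twisted_laplacian G n x U (basis_element n (?bs ! s)) (fst (?bs ! r)) $ snd (?bs ! r) =
      (if r = s then out_weight G x (fst (?bs ! r)) else 0) - transfer_entry G x U (?bs ! r) (?bs ! s)"
    if r: "r < length ?bs" and s: "s < length ?bs" for r s
  proof -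
    obtain v i where vi: "?bs ! r = (v, i)" by fastforce
    obtain w j where wj: "?bs ! s = (w, j)" by fastforce
    have *: "v \<in> verts G" "i < n v" "w \<in> verts G" "j < n w"
      using nth_mem[OF r] nth_mem[OF s] by (auto simp: vi wj set_basis_labels)
    have eq: "r = s \<longleftrightarrow> v = w \<and> i = j"
      using nth_eq_iff_index_eq[OF distinct_basis_labels r s] by (auto simp: vi wj)
    let ?f = "basis_element n (w, j)"
    have f_carrier: "?f u \<in> carrier_vec (n u)" for u by (auto simp: basis_element_def)
    have Uf: "(U e *\<^sub>v ?f (head G e)) $ i = (if head G e = w then U e $$ (i, j) else 0)"
      if "e \<in> out_arcs G v" for e
    proof -
      have "U e \<in> carrier_mat (n v) (n (head G e))" using U_carrier[of e] that by auto
      then show ?thesis using * by (auto simp: basis_element_def)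
    qed
    have carrier: "x e \<cdot>\<^sub>v (?f (tail G e) - U e *\<^sub>v ?f (head G e)) \<in> carrier_vec (n v)"
      if "e \<in> out_arcs G v" for e
      using U_carrier[of e] f_carrier that by (auto intro!: mult_mat_vec_carrier)
    have "twisted_laplacian G n x U ?f v $ i =
        (\<Sum>e\<in>out_arcs G v. (x e \<cdot>\<^sub>v (?f (tail G e) - U e *\<^sub>v ?f (head G e))) $ i)"
      unfolding twisted_laplacian_def
      using * carrier by (intro index_finsum_vec) auto
    also have "\<dots> = (\<Sum>e\<in>out_arcs G v. x e * (if r = s then 1 else 0) - (if head G e = w then x e * U e $$ (i, j) else 0))"
    proof (rule sum.cong)
      fix e assume e: "e \<in> out_arcs G v"
      then have U: "U e \<in> carrier_mat (n v) (n (head G e))" and tail: "tail G e = v"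
        using U_carrier[of e] by auto
      have "?f v $ i = (if r = s then 1 else 0)"
        using * eq by (auto simp: basis_element_def)
      then show "(x e \<cdot>\<^sub>v (?f (tail G e) - U e *\<^sub>v ?f (head G e))) $ i =
          x e * (if r = s then 1 else 0) - (if head G e = w then x e * U e $$ (i, j) else 0)"
        using U tail * Uf[OF e] by (auto simp: algebra_simps)
    qed simp
    also have "\<dots> = (if r = s then out_weight G x v else 0) - transfer_entry G x U (v, i) (w, j)"
      by (simp add: sum_subtractf out_weight_def transfer_entry_def finite_out_arcs sum.inter_filter
          del: in_out_arcs_conv)
    finally show ?thesis by (simp only: vi wj fst_conv snd_conv)
  qed
  show ?thesis
    by (rule eq_matI) (simp_all add: endo_mat_def pencil_def Let_def entry)
qed

text \<open>
  Only the last factor depends on the matrices \<open>U e\<close>; in particular the outer weights are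
  deterministic when \<open>U\<close> is random.
\<close>

theorem det_twisted_laplacian:
  "endo_det G n (twisted_laplacian G n x U) = (\<Sum>C\<in>cycle_msets G n.
     (\<Prod>a\<in>verts G. out_weight G x a ^ (n a - mset_visits G C a)) / of_nat (mset_fact C)
     * (\<Prod>c\<in>#C. - cycle_weight x c / of_nat (cycle_val c))
     * (\<Prod>c\<in>#C. mat_trace (cycle_hol G n U c)))"
  unfolding endo_det_def endo_mat_twisted_laplacian det_pencil
  unfolding mset_weight_def cycle_term_def prod_mset.distrib by (rule sum.cong) simp_all

end

section \<open>Moments\<close>

theorem corollary1p6:
  fixes G :: "(nat, 'e) pre_digraph" and p k :: nat and n :: "nat \<Rightarrow> nat"
    and x :: "'e \<Rightarrow> complex" and M :: "'w measure" and U :: "'w \<Rightarrow> 'e \<Rightarrow> complex mat"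
  assumes "fin_digraph G" and "loopfree_digraph G" and "verts G = {1..p}"
    and "\<And>v. v \<in> verts G \<Longrightarrow> n v \<ge> 1"
    and "prob_space M"
    and "\<And>\<omega> e. \<lbrakk>\<omega> \<in> space M; e \<in> arcs G\<rbrakk> \<Longrightarrow> U \<omega> e \<in> carrier_mat (n (tail G e)) (n (head G e))"
    and "\<And>e i j. \<lbrakk>e \<in> arcs G; i < n (tail G e); j < n (head G e)\<rbrakk> \<Longrightarrow>
           (\<lambda>\<omega>. U \<omega> e $$ (i, j)) \<in> borel_measurable M"
    and "k \<ge> 1"
    and "\<And>C. C \<in> {1..k} \<rightarrow>\<^sub>E cycle_msets G n \<Longrightarrow>
           integrable M (\<lambda>\<omega>. \<Prod>i\<in>{1..k}. \<Prod>c\<in>#C i. mat_trace (cycle_hol G n (U \<omega>) c))"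
  shows "integrable M (\<lambda>\<omega>. endo_det G n (twisted_laplacian G n x (U \<omega>)) ^ k)
    \<and> (\<integral>\<omega>. endo_det G n (twisted_laplacian G n x (U \<omega>)) ^ k \<partial>M) =
      (\<Sum>C \<in> {1..k} \<rightarrow>\<^sub>E cycle_msets G n.
         (\<Prod>i\<in>{1..k}.
            (\<Prod>a\<in>verts G. out_weight G x a ^ (n a - mset_visits G (C i) a)) / of_nat (mset_fact (C i))
            * (\<Prod>c\<in>#C i. - cycle_weight x c / of_nat (cycle_val c)))
         * (\<integral>\<omega>. (\<Prod>i\<in>{1..k}. \<Prod>c\<in>#C i. mat_trace (cycle_hol G n (U \<omega>) c)) \<partial>M))"
proof -
  let ?weight = "\<lambda>C. (\<Prod>a\<in>verts G. out_weight G x a ^ (n a - mset_visits G C a)) / of_nat (mset_fact C)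
      * (\<Prod>c\<in>#C. - cycle_weight x c / of_nat (cycle_val c))"
  let ?loop = "\<lambda>\<omega> C. \<Prod>c\<in>#C. mat_trace (cycle_hol G n (U \<omega>) c)"
  let ?Cs = "{1..k} \<rightarrow>\<^sub>E cycle_msets G n"
  have fin: "finite (cycle_msets G n)" by (rule finite_cycle_msets) fact
  have pow: "endo_det G n (twisted_laplacian G n x (U \<omega>)) ^ k =
      (\<Sum>C\<in>?Cs. (\<Prod>i\<in>{1..k}. ?weight (C i)) * (\<Prod>i\<in>{1..k}. ?loop \<omega> (C i)))"
    if "\<omega> \<in> space M" for \<omega>
  proof -
    interpret quiver_representation G n "U \<omega>"
      using assms(1) assms(6)[OF that]
      by (simp add: quiver_representation_def quiver_representation_axioms_def)
    have "endo_det G n (twisted_laplacian G n x (U \<omega>)) ^ k =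
        (\<Prod>i\<in>{1..k}. \<Sum>C\<in>cycle_msets G n. ?weight C * ?loop \<omega> C)"
      by (simp add: det_twisted_laplacian)
    also have "\<dots> = (\<Sum>C\<in>?Cs. \<Prod>i\<in>{1..k}. ?weight (C i) * ?loop \<omega> (C i))"
      by (rule prod_sum_PiE) (auto simp: fin)
    finally show ?thesis by (simp only: prod.distrib)
  qed
  have int: "integrable M (\<lambda>\<omega>. (\<Prod>i\<in>{1..k}. ?weight (C i)) * (\<Prod>i\<in>{1..k}. ?loop \<omega> (C i)))"
    if "C \<in> ?Cs" for C
    using assms(9)[OF that] by (rule integrable_mult_right)
  let ?det = "\<lambda>\<omega>. endo_det G n (twisted_laplacian G n x (U \<omega>)) ^ k"
  let ?sum = "\<lambda>\<omega>. \<Sum>C\<in>?Cs. (\<Prod>i\<in>{1..k}. ?weight (C i)) * (\<Prod>i\<in>{1..k}. ?loop \<omega> (C i))"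
  have "integrable M ?sum"
    by (rule Bochner_Integration.integrable_sum) (rule int)
  moreover have "integrable M ?det \<longleftrightarrow> integrable M ?sum"
    by (rule Bochner_Integration.integrable_cong[OF refl]) (rule pow)
  moreover have "(\<integral>\<omega>. ?det \<omega> \<partial>M) = (\<integral>\<omega>. ?sum \<omega> \<partial>M)"
    by (rule Bochner_Integration.integral_cong[OF refl]) (rule pow)
  moreover have "(\<integral>\<omega>. ?sum \<omega> \<partial>M) =
      (\<Sum>C\<in>?Cs. \<integral>\<omega>. (\<Prod>i\<in>{1..k}. ?weight (C i)) * (\<Prod>i\<in>{1..k}. ?loop \<omega> (C i)) \<partial>M)"
    by (rule Bochner_Integration.integral_sum) (rule int)
  ultimately show ?thesis by (simp only: integral_mult_right_zero simp_thms)
qed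

end
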